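(* Let $\psi:\mathbb D\to\mathbb C$ be conformal, $\mathcal D$ a dyadic grid on $\mathbb T$, and $q_0\ge1$. Suppose $v=|\psi'|^2\in\mathrm{B}_{q_0^+}(\mathbb D)$. If \[u\in\begin{cases}\mathrm{B}_2(\mathcal D,v),& q_0=1,\\ \mathrm{B}_{\frac{q_0+1}{q_0}}(\mathcal D,v)\cap\mathrm{RH}_{q_0}(\mathcal D,v),&1<q_0<\infty,\end{cases}\] then $u\in\mathrm{B}_2(\mathcal D)$, i.e. $\sup_{I\in\mathcal D}\langle u\rangle_{Q_I}\langle u^{-1}\rangle_{Q_I}<\infty$.
   Context: $\mathbb D$ is the open unit disc, $\mathbb T$ the unit circle, $dA$ normalized area measure. A weight is a locally integrable, a.e. positive function. For measurable $f$, $0<p<\infty$, weight $v$, measurable $E$: $\langle f\rangle_{p,v,E}=\big(\int_E|f|^pv\,dA\big)^{1/p}/\big(\int_Ev\,dA\big)^{1/p}$; for $p=\infty$ it is $\|f\|_{L^\infty(E)}$; $v$ omitted when $v\equiv1$, $p$ omitted when $p=1$. For an arc $I\subset\mathbb T$ with center $e^{i\theta_0}$ and normalized arclength $\ell(I)$ ($\ell(\mathbb T)=1$), $Q_I=\{re^{i\theta}\in\mathbb D:1-r\le\ell(I),|\theta-\theta_0|\le\ell(I)/2\}$ and its top half is $T_I=\{re^{i\theta}\in\mathbb D:\ell(I)/2\le1-r\le\ell(I),|\theta-\theta_0|\le\ell(I)/2\}$. A dyadic grid $\mathcal D$ is a collection of arcs of $\mathbb T$ such that: for each $k\in\mathbb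 N$, $\{I\in\mathcal D:\ell(I)=2^{-k}\}$ partitions $\mathbb T$; $\{T_I:I\in\mathcal D\}$ partitions $\mathbb D$; any two arcs of $\mathcal D$ are disjoint or nested; each $I\in\mathcal D$ is the union of $2^k$ arcs of $\mathcal D$ of length $2^{-k}\ell(I)$ (e.g. $\{[2\pi j2^{-k},2\pi(j+1)2^{-k}):0\le j<2^k\}$). For $1\le p<\infty$: $u\in\mathrm{B}_p(\mathbb D)$ means $\sup_I\langle u\rangle_{Q_I}\langle u^{-1}\rangle_{\frac1{p-1},Q_I}<\infty$ over all arcs $I$; $\mathrm{B}_{q_0^+}(\mathbb D)=\bigcap_{q>q_0}\mathrm{B}_q(\mathbb D)$; $[u]_{\mathrm{B}_p(\mathcal D,v)}=\sup_{I\in\mathcal D}\langle u\rangle_{v,Q_I}\langle u^{-1}\rangle_{\frac1{p-1},v,Q_I}$ and $u\in\mathrm{B}_p(\mathcal D,v)$ if finite; $\mathrm{B}_p(\mathcal D)=\mathrm{B}_p(\mathcal D,1)$. For $1<s<\infty$, $u\in\mathrm{RH}_s(\mathcal D,v)$ if $\sup_{I\in\mathcal D}\langle u\rangle_{s,v,Q_I}(\langle u\rangle_{v,Q_I})^{-1}<\infty$. *)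

theory Defs
  imports "HOL-Analysis.Analysis" "HOL-Probability.Essential_Supremum"
begin

text \<open>An arc with starting angle a and normalized arclength l (0 < l <= 1): it contains
  the open arc of angles (a, a + 2 pi l) and is contained in the closed one (so open,
  closed and half-open arcs are all allowed).\<close>

definition arc_rep :: "complex set \<Rightarrow> real \<Rightarrow> real \<Rightarrow> bool" where
  "arc_rep I a l \<longleftrightarrow> 0 < l \<and> l \<le> 1 \<and>
     cis ` {a<..<a + 2*pi*l} \<subseteq> I \<and> I \<subseteq> cis ` {a..a + 2*pi*l}"

definition is_arc :: "complex set \<Rightarrow> bool" where
  "is_arc I \<longleftrightarrow> (\<exists>a l. arc_rep I a l)"

definition arc_len :: "complex set \<Rightarrow> real" where
  "arc_len I = (SOME l. \<exists>a. arc_rep I a l)"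

definition arc_mid :: "complex set \<Rightarrow> real" where
  "arc_mid I = (SOME t. \<exists>a. arc_rep I a (arc_len I) \<and> t = a + pi * arc_len I)"

text \<open>Carleson box Q_I and its top half T_I. Angles are measured so that the angular
  half-width of the box equals that of the arc (pi * l(I) radians, i.e. l(I)/2 in
  normalized angle).\<close>

definition Qbox :: "complex set \<Rightarrow> complex set" where
  "Qbox I = {z. norm z < 1 \<and> 1 - norm z \<le> arc_len I \<and>
     (\<exists>t. z = complex_of_real (norm z) * cis t \<and> \<bar>t - arc_mid I\<bar> \<le> pi * arc_len I)}"

definition Tbox :: "complex set \<Rightarrow> complex set" where
  "Tbox I = {z. norm z < 1 \<and> arc_len I / 2 \<le> 1 - norm z \<and> 1 - norm z \<le> arc_len I \<and>
     (\<exists>t. z = complex_of_real (norm z) * cis t \<and> \<bar>t - arc_mid I\<bar> \<le> pi * arc_len I)}"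

text \<open>The top halves T_I partition the disc up to (Lebesgue-)null overlaps on their
  boundaries (closed boxes cannot literally be disjoint).\<close>

definition dyadic_grid :: "complex set set \<Rightarrow> bool" where
  "dyadic_grid \<D> \<longleftrightarrow>
     (\<forall>I\<in>\<D>. is_arc I) \<and>
     (\<forall>k::nat. pairwise disjnt {I\<in>\<D>. arc_len I = 1 / 2^k} \<and>
               \<Union>{I\<in>\<D>. arc_len I = 1 / 2^k} = sphere 0 1) \<and>
     (\<Union>I\<in>\<D>. Tbox I) = ball 0 1 \<and>
     (\<forall>I\<in>\<D>. \<forall>J\<in>\<D>. I \<noteq> J \<longrightarrow> Tbox I \<inter> Tbox J \<in> null_sets lborel) \<and>
     (\<forall>I\<in>\<D>. \<forall>J\<in>\<D>. disjnt I J \<or> I \<subseteq> J \<or> J \<subseteq> I) \<and>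
     (\<forall>I\<in>\<D>. \<forall>k::nat. \<exists>S\<subseteq>\<D>. finite S \<and> card S = 2^k \<and>
          (\<forall>J\<in>S. arc_len J = arc_len I / 2^k) \<and> \<Union>S = I)"

text \<open>Area measure: Lebesgue measure on the plane (normalization cancels in all
  averages).\<close>

definition weight :: "(complex \<Rightarrow> real) \<Rightarrow> bool" where
  "weight u \<longleftrightarrow> (\<forall>K. compact K \<and> K \<subseteq> ball 0 1 \<longrightarrow> set_integrable lborel K u) \<and>
                  (AE z in lborel. z \<in> ball 0 1 \<longrightarrow> 0 < u z)"

definition wavg :: "real \<Rightarrow> (complex \<Rightarrow> real) \<Rightarrow> complex set \<Rightarrow> (complex \<Rightarrow> real) \<Rightarrow> real" where
  "wavg p v E f = ((LINT z:E|lborel. \<bar>f z\<bar> powr p * v z) / (LINT z:E|lborel. v z)) powr (1/p)"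

definition inv_finite :: "real \<Rightarrow> (complex \<Rightarrow> real) \<Rightarrow> complex set \<Rightarrow> (complex \<Rightarrow> real) \<Rightarrow> bool" where
  "inv_finite p v E u \<longleftrightarrow>
     (if p = 1 then esssup (restrict_space lborel E) (\<lambda>z. ereal (inverse (u z))) < \<infinity>
      else set_integrable lborel E (\<lambda>z. inverse (u z) powr (1/(p-1)) * v z))"

definition inv_avg :: "real \<Rightarrow> (complex \<Rightarrow> real) \<Rightarrow> complex set \<Rightarrow> (complex \<Rightarrow> real) \<Rightarrow> real" where
  "inv_avg p v E u =
     (if p = 1 then real_of_ereal (esssup (restrict_space lborel E) (\<lambda>z. ereal (inverse (u z))))
      else wavg (1/(p-1)) v E (\<lambda>z. inverse (u z)))"

definition Bclass :: "real \<Rightarrow> (complex \<Rightarrow> real) \<Rightarrow> complex set set \<Rightarrow> (complex \<Rightarrow> real) \<Rightarrow> bool" where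
  "Bclass p v \<J> u \<longleftrightarrow> (\<exists>C. \<forall>I\<in>\<J>.
      set_integrable lborel (Qbox I) v \<and>
      set_integrable lborel (Qbox I) (\<lambda>z. u z * v z) \<and>
      inv_finite p v (Qbox I) u \<and>
      wavg 1 v (Qbox I) u * inv_avg p v (Qbox I) u \<le> C)"

definition all_arcs :: "complex set set" where
  "all_arcs = {I. is_arc I}"

definition RHclass :: "real \<Rightarrow> (complex \<Rightarrow> real) \<Rightarrow> complex set set \<Rightarrow> (complex \<Rightarrow> real) \<Rightarrow> bool" where
  "RHclass s v \<J> u \<longleftrightarrow> (\<exists>C. \<forall>I\<in>\<J>.
      set_integrable lborel (Qbox I) v \<and>
      set_integrable lborel (Qbox I) (\<lambda>z. u z * v z) \<and>
      set_integrable lborel (Qbox I) (\<lambda>z. \<bar>u z\<bar> powr s * v z) \<and>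
      wavg s v (Qbox I) u \<le> C * wavg 1 v (Qbox I) u)"

end

theory Submission
  imports Defs "HOL-Complex_Analysis.Complex_Analysis"
begin

text \<open>
  Put \<open>v = |\<psi>'|\<^sup>2\<close>. Since \<open>\<psi>'\<close> has no zeros, every real power of \<open>|\<psi>'|\<close> has the sub-mean value
  property, so the \<open>B\<^sub>q\<close> condition itself (no distortion theorem is needed) makes \<open>v\<close> comparable to a
  constant on each top half \<open>T\<^sub>I\<close>, with constants growing at most geometrically from one generation to
  the next. In both cases the hypothesis says that \<open>\<integral> u\<^sup>q v \<cdot> \<integral> u\<^sup>-\<^sup>q v \<le> M (\<integral> v)\<^sup>2\<close> on every \<open>Q\<^sub>I\<close>, with
  \<open>q = q\<^sub>0\<close>. By Cauchy--Schwarz on \<open>T\<^sub>I\<close>, a fixed fraction of the mass of \<open>u\<^sup>q v\<close> and of \<open>u\<^sup>-\<^sup>q v\<close> in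
  \<open>Q\<^sub>I\<close> lies in \<open>T\<^sub>I\<close>, so the mass of the \<open>n\<close>-th layer of \<open>Q\<^sub>I\<close> decays geometrically in \<open>n\<close>. This gives
  the averages of \<open>u\<close> and \<open>1/u\<close> over the top halves a higher integrability exponent
  \<open>q\<^sub>0 (1 + \<epsilon>)\<close> with respect to \<open>v\<close>, and Hoelder's inequality against the \<open>B\<^bsub>q\<^sub>0(1+\<epsilon>)\<^esub>\<close>
  condition on \<open>v\<close> removes the weight.
\<close>

section \<open>Sub-mean value property over discs\<close>

text \<open>The weight \<open>v\<close> is known to lie in B_q only for q > q0, so the bounds on
  u^q0 and u^(-q0) cannot be paired with it directly: the exponent on the side of u has to be raised
  first, by an amount \<epsilon> that depends on the constants. This is not circular. The pointwise
  estimates on \<open>v\<close> use the fixed exponent q0 + 1; together with M they fix the decay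
  and growth rates, hence \<epsilon>, and only then is B_q invoked with q = q0 (1 + \<epsilon>). A
  disc about a point of Q_I sticks out of Q_I, so the sub-mean value property compares
  \<open>v\<close> with its integral over the box of the tripled arc. That arc need not belong to
  the grid, and this is where the B_q condition over all arcs enters. The larger integral serves as
  V I in all later ratios; since it dominates the integral over Q_I, the bound M survives the
  replacement. Closed boxes meet along rays and circles, so set identities are proved almost
  everywhere and masses are computed in \<open>ennreal\<close>.\<close>

lemma lborel_complex_eq_distr_prod:
  "lborel = distr (lborel :: (real \<times> real) measure) borel (\<lambda>(x, y). Complex x y)"
proof (rule lborel_eqI)
  have m: "(\<lambda>(x, y). Complex x y) \<in> borel_measurable (lborel :: (real \<times> real) measure)"
    by (auto intro!: borel_measurable_continuous_onI continuous_intros simp: Complex_eq case_prod_unfold)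
  fix l u :: complex
  assume lu: "\<And>b. b \<in> Basis \<Longrightarrow> l \<bullet> b \<le> u \<bullet> b"
  have vimage: "(\<lambda>(x, y). Complex x y) -` box l u \<inter> space lborel = box (Re l, Im l) (Re u, Im u)"
    by (auto simp: box_def Basis_complex_def Basis_prod_def inner_complex_def ball_Un)
  have "Re l \<le> Re u" "Im l \<le> Im u"
    using lu[of 1] lu[of \<i>] by (auto simp: Basis_complex_def inner_complex_def)
  moreover have "emeasure (distr (lborel :: (real \<times> real) measure) borel (\<lambda>(x, y). Complex x y)) (box l u)
      = emeasure lborel (box (Re l, Im l) (Re u, Im u))"
    by (subst emeasure_distr[OF m]) (auto simp: vimage simp del: space_lborel)
  ultimately show "emeasure (distr (lborel :: (real \<times> real) measure) borel (\<lambda>(x, y). Complex x y)) (box l u)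
      = (\<Prod>b\<in>Basis. (u - l) \<bullet> b)"
    by (auto simp: emeasure_lborel_box_eq simp: Basis_complex_def Basis_prod_def inner_complex_def ennreal_mult mult.commute
        prod.union_disjoint prod.reindex inj_on_def image_iff)
qed simp

lemma nn_integral_lborel_complex:
  assumes [measurable]: "f \<in> borel_measurable borel"
  shows "(\<integral>\<^sup>+z. f z \<partial>lborel) = (\<integral>\<^sup>+x. \<integral>\<^sup>+y. f (Complex x y) \<partial>lborel \<partial>lborel)"
    and "(\<integral>\<^sup>+z. f z \<partial>lborel) = (\<integral>\<^sup>+y. \<integral>\<^sup>+x. f (Complex x y) \<partial>lborel \<partial>lborel)"
proof -
  have m: "(\<lambda>p. Complex (fst p) (snd p)) \<in> borel_measurable (borel :: (real \<times> real) measure)"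
    by (auto intro!: borel_measurable_continuous_onI continuous_intros simp: Complex_eq)
  then have m2 [measurable]: "(\<lambda>p. Complex (fst p) (snd p)) \<in> borel_measurable (borel \<Otimes>\<^sub>M borel)"
    by (simp add: borel_prod)
  have "(\<integral>\<^sup>+z. f z \<partial>lborel) = (\<integral>\<^sup>+p. f (Complex (fst p) (snd p)) \<partial>(lborel \<Otimes>\<^sub>M lborel))"
    using m by (subst lborel_complex_eq_distr_prod, subst nn_integral_distr)
      (auto simp: case_prod_unfold lborel_prod)
  moreover have "(\<lambda>p. f (Complex (fst p) (snd p))) \<in> borel_measurable (lborel \<Otimes>\<^sub>M lborel)"
    by measurable
  ultimately show "(\<integral>\<^sup>+z. f z \<partial>lborel) = (\<integral>\<^sup>+x. \<integral>\<^sup>+y. f (Complex x y) \<partial>lborel \<partial>lborel)"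
    and "(\<integral>\<^sup>+z. f z \<partial>lborel) = (\<integral>\<^sup>+y. \<integral>\<^sup>+x. f (Complex x y) \<partial>lborel \<partial>lborel)"
    using lborel.nn_integral_fst[of "\<lambda>p. f (Complex (fst p) (snd p))"]
      lborel_pair.nn_integral_snd[of "\<lambda>p. f (Complex (fst p) (snd p))"]
    by (auto simp: case_prod_unfold)
qed

lemma nn_integral_real_translate:
  assumes [measurable]: "f \<in> borel_measurable borel"
  shows "(\<integral>\<^sup>+x. f (x + c) \<partial>lborel) = (\<integral>\<^sup>+x. f (x::real) \<partial>lborel)"
  using nn_integral_real_affine[of f 1 c] by (simp add: add.commute)

lemma Complex_measurable [measurable]:
  "(\<lambda>x. Complex x y) \<in> borel_measurable borel" "Complex x \<in> borel_measurable borel"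
  by (auto intro!: borel_measurable_continuous_onI continuous_intros simp: Complex_eq)

text \<open>On each horizontal or vertical line a shear is a translation, so Fubini in the right
  order reduces both claims to translation invariance.\<close>

lemma nn_integral_shear:
  fixes f :: "complex \<Rightarrow> ennreal"
  assumes [measurable]: "f \<in> borel_measurable borel"
  shows "(\<integral>\<^sup>+z. f (Complex (Re z - t * Im z) (Im z)) \<partial>lborel) = (\<integral>\<^sup>+z. f z \<partial>lborel)"
    and "(\<integral>\<^sup>+z. f (Complex (Re z) (Im z + t * Re z)) \<partial>lborel) = (\<integral>\<^sup>+z. f z \<partial>lborel)"
proof -
  have [measurable]: "(\<lambda>z. Complex (Re z - t * Im z) (Im z)) \<in> borel_measurable borel"
    "(\<lambda>z. Complex (Re z) (Im z + t * Re z)) \<in> borel_measurable borel"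
    by (auto intro!: borel_measurable_continuous_onI continuous_intros simp: Complex_eq)
  show "(\<integral>\<^sup>+z. f (Complex (Re z - t * Im z) (Im z)) \<partial>lborel) = (\<integral>\<^sup>+z. f z \<partial>lborel)"
    using nn_integral_real_translate[of "\<lambda>x. f (Complex x y)" "- (t * y)" for y]
    by (simp add: nn_integral_lborel_complex(2))
  show "(\<integral>\<^sup>+z. f (Complex (Re z) (Im z + t * Re z)) \<partial>lborel) = (\<integral>\<^sup>+z. f z \<partial>lborel)"
    using nn_integral_real_translate[of "\<lambda>y. f (Complex x y)" "t * x" for x]
    by (simp add: nn_integral_lborel_complex(1))
qed

text \<open>A rotation other than by a half turn is a product of three shears.\<close>

lemma nn_integral_rotate:
  fixes f :: "complex \<Rightarrow> ennreal"
  assumes f [measurable]: "f \<in> borel_measurable borel" and c: "norm c = 1"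
  shows "(\<integral>\<^sup>+z. f (c * z) \<partial>lborel) = (\<integral>\<^sup>+z. f z \<partial>lborel)"
proof -
  have rot: "(\<integral>\<^sup>+z. h (c * z) \<partial>lborel) = (\<integral>\<^sup>+z. h z \<partial>lborel)"
    if [measurable]: "h \<in> borel_measurable borel" and c: "norm c = 1" "c \<noteq> -1"
    for c :: complex and h :: "complex \<Rightarrow> ennreal"
  proof -
    define a b where "a = Re c" and "b = Im c"
    have ab: "a\<^sup>2 + b\<^sup>2 = 1"
      using c by (simp add: a_def b_def cmod_def)
    have "a \<noteq> -1"
      using ab c by (auto simp: a_def b_def complex_eq_iff)
    \<comment> \<open>For a rotation by the angle x this is tan (x / 2). It has no value at a = -1,
      the half turn.\<close>
    define t where "t = b / (1 + a)"
    have t: "t * (1 + a) = b" "1 - t * b = a"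
    proof -
      show 1: "t * (1 + a) = b"
        using \<open>a \<noteq> -1\<close> by (simp add: t_def add_eq_0_iff2)
      have "t * b * (1 + a) = (t * (1 + a)) * b"
        by (simp add: algebra_simps)
      also have "\<dots> = (1 - a) * (1 + a)"
        unfolding 1 using ab by (simp add: algebra_simps power2_eq_square)
      finally have "t * b * (1 + a) = (1 - a) * (1 + a)" .
      moreover have "1 + a \<noteq> 0"
        using \<open>a \<noteq> -1\<close> by auto
      ultimately show "1 - t * b = a"
        by simp
    qed
    define sh1 where "sh1 = (\<lambda>z. Complex (Re z - t * Im z) (Im z))"
    define sh2 where "sh2 = (\<lambda>z. Complex (Re z) (Im z + b * Re z))"
    have [measurable]: "sh1 \<in> borel_measurable borel" "sh2 \<in> borel_measurable borel"
      by (auto intro!: borel_measurable_continuous_onI continuous_intros simp: Complex_eq sh1_def sh2_def)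
    have "c * z = sh1 (sh2 (sh1 z))" for z
    proof (rule complex_eqI)
      have "Im z + b * (Re z - t * Im z) = b * Re z + (1 - t * b) * Im z"
        by (simp add: algebra_simps)
      then show "Im (c * z) = Im (sh1 (sh2 (sh1 z)))"
        by (simp add: t(2) sh1_def sh2_def flip: a_def b_def)
      have "(Re z - t * Im z) - t * (Im z + b * (Re z - t * Im z))
          = (1 - t * b) * Re z - t * (1 + (1 - t * b)) * Im z"
        by (simp add: algebra_simps)
      then show "Re (c * z) = Re (sh1 (sh2 (sh1 z)))"
        by (simp add: t sh1_def sh2_def flip: a_def b_def)
    qed
    then have "(\<integral>\<^sup>+z. h (c * z) \<partial>lborel) = (\<integral>\<^sup>+z. h (sh1 (sh2 (sh1 z))) \<partial>lborel)"
      by simp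
    also have "\<dots> = (\<integral>\<^sup>+z. h z \<partial>lborel)"
    proof -
      have sh: "(\<integral>\<^sup>+z. k (sh1 z) \<partial>lborel) = (\<integral>\<^sup>+z. k z \<partial>lborel)"
        "(\<integral>\<^sup>+z. k (sh2 z) \<partial>lborel) = (\<integral>\<^sup>+z. k z \<partial>lborel)"
        if "k \<in> borel_measurable borel" for k :: "complex \<Rightarrow> ennreal"
        using nn_integral_shear[OF that] by (simp_all add: sh1_def sh2_def)
      show ?thesis
        using sh(1)[of "\<lambda>z. h (sh1 (sh2 z))"] sh(2)[of "\<lambda>z. h (sh1 z)"] sh(1)[of h] by simp
    qed
    finally show ?thesis .
  qed
  show ?thesis
  proof (cases "c = -1")
    \<comment> \<open>A half turn is two quarter turns, and \<open>\<i>\<close> is covered by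
      \<open>rot\<close>.\<close>
    case True
    have "(\<integral>\<^sup>+z. f (\<i> * (\<i> * z)) \<partial>lborel) = (\<integral>\<^sup>+z. f z \<partial>lborel)"
      using rot[of "\<lambda>z. f (\<i> * z)" \<i>] rot[of f \<i>] by (simp add: complex_eq_iff)
    then show ?thesis
      using True by (simp flip: mult.assoc)
  qed (use rot c f in auto)
qed

text \<open>Cauchy's formula is applied on the unit circle to
  \<open>H x = G (w + x * \<zeta>)\<close>. This admits \<zeta> = 0 and keeps \<zeta> as the
  starting point of the circle, so that \<zeta> can later be averaged over a disc.\<close>

lemma circle_mean_value:
  assumes "G holomorphic_on ball w r" "norm \<zeta> < r"
  shows "((\<lambda>t. G (w + cis (2 * pi * t) * \<zeta>)) has_integral G w) {0..1}"
proof -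
  define H where "H x = G (w + x * \<zeta>)" for x
  have sub: "(\<lambda>x. w + x * \<zeta>) ` cball 0 1 \<subseteq> ball w r"
    using assms(2) by (auto simp: dist_norm norm_mult intro!: le_less_trans[OF mult_left_le_one_le])
  have hol: "H holomorphic_on cball 0 1"
    unfolding H_def
    by (rule holomorphic_on_compose_gen[OF _ assms(1) sub, unfolded o_def]) (intro holomorphic_intros)
  have "((\<lambda>u. H u / (u - 0)) has_contour_integral (2 * of_real pi * \<i>) * H 0) (circlepath 0 1)"
    using hol by (intro Cauchy_integral_circlepath)
      (auto intro: holomorphic_on_imp_continuous_on holomorphic_on_subset[of _ "cball 0 1"])
  then have "((\<lambda>t. (2 * of_real pi * \<i>) * H (cis (2 * pi * t))) has_integral (2 * of_real pi * \<i>) * H 0) {0..1}"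
    unfolding has_contour_integral
    by (rule has_integral_eq[rotated])
      (auto simp: vector_derivative_circlepath01 vector_derivative_circlepath,
       simp add: circlepath cis_conv_exp mult_ac)
  then have "((\<lambda>t. H (cis (2 * pi * t))) has_integral H 0) {0..1}"
    by (subst (asm) has_integral_mult_right_iff) auto
  then show ?thesis
    by (simp add: H_def)
qed

lemma norm_circle_mean_le:
  assumes "G holomorphic_on ball w r" "norm \<zeta> < r"
  shows "ennreal (norm (G w)) \<le> (\<integral>\<^sup>+t. ennreal (norm (G (w + cis (2 * pi * t) * \<zeta>))) * indicator {0..1} t \<partial>lborel)"
proof -
  let ?g = "\<lambda>t. G (w + cis (2 * pi * t) * \<zeta>)"
  have cont: "continuous_on {0..1} ?g"
    using holomorphic_on_imp_continuous_on[OF assms(1)] assms(2)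
    by (intro continuous_on_compose2[where g = G and s = "{0..1}"])
       (auto intro!: continuous_intros simp: dist_norm norm_mult)
  have "norm (G w) \<le> integral {0..1} (\<lambda>t. norm (?g t))"
    using circle_mean_value[OF assms] integral_norm_bound_integral[of ?g "{0..1}" "\<lambda>t. norm (?g t)"] cont
    by (auto simp: has_integral_iff integrable_continuous_real continuous_on_norm)
  then have "ennreal (norm (G w)) \<le> ennreal (integral {0..1} (\<lambda>t. norm (?g t)))"
    by (rule ennreal_leI)
  also have "ennreal (integral {0..1} (\<lambda>t. norm (?g t))) = (\<integral>\<^sup>+t. ennreal (norm (?g t) * indicator {0..1} t) \<partial>lborel)"
  proof -
    have "set_integrable lborel {0..1} (\<lambda>t. norm (?g t))"
      using cont by (intro borel_integrable_atLeastAtMost') (auto intro: continuous_on_norm)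
    then have "integral {0..1} (\<lambda>t. norm (?g t)) = (LINT t:{0..1}|lborel. norm (?g t))"
      and "integrable lborel (\<lambda>t. norm (?g t) * indicator {0..1} t)"
      by (auto simp: set_borel_integral_eq_integral set_integrable_def mult.commute)
    then show ?thesis
      by (subst nn_integral_eq_integral) (auto simp: set_lebesgue_integral_def mult.commute)
  qed
  finally show ?thesis
    by (auto simp: ennreal_mult' ennreal_indicator)
qed

text \<open>Averaging the circle inequality over \<zeta> in the disc and swapping the integrals
  leaves, for each fixed t, the integral of a rotated function; rotation invariance makes it
  independent of t. This replaces integration in polar coordinates.\<close>

lemma holomorphic_area_submean:
  assumes G: "G holomorphic_on ball w r" and "0 < r"
  shows "ennreal (norm (G w)) * emeasure lborel (ball w r) \<le> (\<integral>\<^sup>+z. ennreal (norm (G z)) * indicator (ball w r) z \<partial>lborel)"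
proof -
  define h where "h \<zeta> = ennreal (norm (G (w + \<zeta>))) * indicator (ball 0 r) \<zeta>" for \<zeta>
  have cont: "continuous_on (ball 0 r) (\<lambda>\<zeta>. norm (G (w + \<zeta>)))"
    using holomorphic_on_imp_continuous_on[OF G]
    by (rule continuous_on_norm[OF continuous_on_compose2[of "ball w r" G]])
       (auto intro!: continuous_intros simp: dist_norm)
  have "(\<lambda>\<zeta>. norm (G (w + \<zeta>)) * indicator (ball 0 r) \<zeta>) \<in> borel_measurable borel"
    using borel_measurable_continuous_on_indicator[OF _ cont] by (simp add: mult.commute)
  then have h [measurable]: "h \<in> borel_measurable borel"
    unfolding h_def by (simp flip: ennreal_indicator ennreal_mult')
  have [measurable]: "(\<lambda>p. cis (2 * pi * fst p) * snd p) \<in> borel_measurable (lborel \<Otimes>\<^sub>M lborel)"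
    by (simp add: lborel_prod) (intro borel_measurable_continuous_onI continuous_intros)
  have plus: "(\<integral>\<^sup>+z. f (w + z) \<partial>lborel) = (\<integral>\<^sup>+z. f z \<partial>lborel)"
    if [measurable]: "f \<in> borel_measurable borel" for f :: "complex \<Rightarrow> ennreal"
    by (subst (2) lborel_distr_plus[of w, symmetric], subst nn_integral_distr) auto
  have "ennreal (norm (G w)) * emeasure lborel (ball w r) = (\<integral>\<^sup>+\<zeta>. ennreal (norm (G w)) * indicator (ball w r) \<zeta> \<partial>lborel)"
    by (subst nn_integral_cmult_indicator) auto
  also have "\<dots> = (\<integral>\<^sup>+\<zeta>. ennreal (norm (G w)) * indicator (ball (0::complex) r) \<zeta> \<partial>lborel)"
    by (subst plus[symmetric]) (auto intro!: nn_integral_cong simp: indicator_def dist_norm)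
  also have "\<dots> \<le> (\<integral>\<^sup>+\<zeta>. (\<integral>\<^sup>+t. h (cis (2 * pi * t) * \<zeta>) * indicator {0..1} t \<partial>lborel) \<partial>lborel)"
  proof (intro nn_integral_mono)
    fix \<zeta> :: complex
    show "ennreal (norm (G w)) * indicator (ball 0 r) \<zeta> \<le> (\<integral>\<^sup>+t. h (cis (2 * pi * t) * \<zeta>) * indicator {0..1} t \<partial>lborel)"
      using norm_circle_mean_le[OF G, of \<zeta>] by (cases "norm \<zeta> < r") (auto simp: h_def norm_mult)
  qed
  also have "\<dots> = (\<integral>\<^sup>+t. (\<integral>\<^sup>+\<zeta>. h (cis (2 * pi * t) * \<zeta>) * indicator {0..1} t \<partial>lborel) \<partial>lborel)"
    by (subst lborel_pair.Fubini'[where f = "\<lambda>t \<zeta>. h (cis (2 * pi * t) * \<zeta>) * indicator {0..1} t"])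
       (auto simp: case_prod_unfold)
  also have "\<dots> = (\<integral>\<^sup>+t. (\<integral>\<^sup>+\<zeta>. h \<zeta> \<partial>lborel) * indicator {0..1::real} t \<partial>lborel)"
  proof (rule nn_integral_cong)
    fix t :: real
    have "(\<integral>\<^sup>+\<zeta>. h (cis (2 * pi * t) * \<zeta>) * indicator {0..1} t \<partial>lborel)
        = (\<integral>\<^sup>+\<zeta>. h (cis (2 * pi * t) * \<zeta>) \<partial>lborel) * indicator {0..1} t"
      by (rule nn_integral_multc) measurable
    then show "(\<integral>\<^sup>+\<zeta>. h (cis (2 * pi * t) * \<zeta>) * indicator {0..1} t \<partial>lborel)
        = (\<integral>\<^sup>+\<zeta>. h \<zeta> \<partial>lborel) * indicator {0..1} t"
      by (simp add: nn_integral_rotate)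
  qed
  also have "\<dots> = (\<integral>\<^sup>+\<zeta>. h \<zeta> \<partial>lborel)"
    by (simp add: nn_integral_cmult)
  also have "\<dots> = (\<integral>\<^sup>+z. ennreal (norm (G z)) * indicator (ball w r) z \<partial>lborel)"
  proof -
    have "(\<lambda>z. h (z - w)) \<in> borel_measurable borel"
      by measurable
    from plus[OF this] show ?thesis
      by (simp add: h_def) (auto intro!: nn_integral_cong simp: indicator_def dist_norm norm_minus_commute)
  qed
  finally show ?thesis .
qed

text \<open>On a disc a zero-free \<open>g\<close> has a holomorphic logarithm \<open>h\<close>, and
  |g|^p is the modulus of the holomorphic function exp (p h). Negative p is the case that will bound
  a weight from below.\<close>

lemma powr_norm_area_submean:
  fixes p :: real
  assumes g: "g holomorphic_on ball w r" and nz: "\<And>z. z \<in> ball w r \<Longrightarrow> g z \<noteq> 0" and "0 < r"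
  shows "ennreal (norm (g w) powr p) * emeasure lborel (ball w r)
    \<le> (\<integral>\<^sup>+z. ennreal (norm (g z) powr p) * indicator (ball w r) z \<partial>lborel)"
proof -
  obtain h where h: "h holomorphic_on ball w r" "\<And>z. z \<in> ball w r \<Longrightarrow> g z = exp (h z)"
    using contractible_imp_holomorphic_log[OF g convex_imp_contractible[OF convex_ball] nz] by metis
  have "norm (exp (p * h z)) = norm (g z) powr p" if "z \<in> ball w r" for z
    using h(2)[OF that] by (simp add: powr_def mult.commute)
  moreover have "(\<lambda>z. exp (p * h z)) holomorphic_on ball w r"
    using h(1) by (intro holomorphic_intros)
  ultimately show ?thesis
    using holomorphic_area_submean[of "\<lambda>z. exp (p * h z)" w r] \<open>0 < r\<close>
    by (auto simp: indicator_def intro: order_trans intro!: nn_integral_mono)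
qed

section \<open>Geometry of arcs and boxes\<close>

text \<open>The choice behind \<open>arc_mid\<close> is made among representations of length
  \<open>arc_len I\<close>, so both chosen values are realised by one representation.\<close>

lemma arc_rep_arc_mid:
  assumes "is_arc I"
  shows "arc_rep I (arc_mid I - pi * arc_len I) (arc_len I)"
proof -
  have "\<exists>a. arc_rep I a (arc_len I)"
    using assms unfolding arc_len_def is_arc_def by (metis (mono_tags, lifting) someI_ex)
  then have "\<exists>t a. arc_rep I a (arc_len I) \<and> t = a + pi * arc_len I"
    by blast
  then have "\<exists>a. arc_rep I a (arc_len I) \<and> arc_mid I = a + pi * arc_len I"
    unfolding arc_mid_def by (rule someI_ex)
  then show ?thesis
    by auto
qed

lemma arc_len_bounds:
  assumes "is_arc I"
  shows "0 < arc_len I" "arc_len I \<le> 1"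
  using arc_rep_arc_mid[OF assms] by (auto simp: arc_rep_def)

text \<open>A longer open arc cannot fit into a shorter closed one: it would contain an angle
  strictly between the end of the short arc and the start of its next copy one turn later. Hence the
  length chosen in \<open>arc_len\<close> is unique.\<close>

lemma arc_rep_len_le:
  assumes "arc_rep I a l" "arc_rep I a' l'"
  shows "l' \<le> l"
proof (rule ccontr)
  assume "\<not> l' \<le> l"
  then have ll: "l < l'" by simp
  define k where "k = \<lfloor>(a' - a) / (2 * pi)\<rfloor>"
  \<comment> \<open>The copy of the starting angle a for which a' lies in the turn from b to b + 2
    pi.\<close>
  define b where "b = a + 2 * pi * k"
  have "of_int k \<le> (a' - a) / (2 * pi)" "(a' - a) / (2 * pi) < of_int k + 1"
    unfolding k_def by linarith+
  then have b: "b \<le> a'" "a' < b + 2 * pi"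
    by (auto simp: b_def field_simps)
  have l: "0 < l" "l' \<le> 1"
    using assms by (auto simp: arc_rep_def)
  define L L' where "L = 2 * pi * l" and "L' = 2 * pi * l'"
  have pl: "L < L'" "L' \<le> 2 * pi" "0 < L"
    using ll l by (auto simp: L_def L'_def)
  have "max a' (b + L) < min (a' + L') (b + 2 * pi)"
    using b pl by auto
  then obtain t where t: "max a' (b + L) < t" "t < min (a' + L') (b + 2 * pi)"
    using dense by blast
  have "cis t \<in> cis ` {a..a + L}"
    using assms t unfolding arc_rep_def L_def L'_def by (meson greaterThanLessThan_iff imageI max_less_iff_conj min_less_iff_conj subsetD)
  then obtain s where s: "cis t = cis s" "a \<le> s" "s \<le> a + L"
    by auto
  then obtain n :: int where n: "t = s + 2 * pi * n"
    using sin_cos_eq_iff[of t s] by (auto simp: complex_eq_iff)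
  have "b + L < t" "t < b + 2 * pi"
    using t by auto
  \<comment> \<open>The two bounds amount to k < n < k + 1 for integers k and n.\<close>
  then have "2 * pi * of_int k < 2 * pi * of_int n" "2 * pi * of_int n < 2 * pi * of_int k + 2 * pi * 1"
    using s(2,3) n unfolding b_def by linarith+
  then have "2 * pi * of_int k < 2 * pi * of_int n" "2 * pi * of_int n < 2 * pi * (of_int k + 1)"
    unfolding distrib_left by blast+
  then show False
    by simp
qed

lemma arc_len_eqI:
  assumes "arc_rep I a l"
  shows "arc_len I = l"
proof -
  have "is_arc I"
    using assms by (auto simp: is_arc_def)
  from arc_rep_arc_mid[OF this] assms show ?thesis
    by (meson antisym arc_rep_len_le)
qed

section \<open>Boxes up to null sets, their measurability and their area\<close>

lemma null_sets_lborel_line: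
  assumes "c \<noteq> (0::complex)"
  shows "{z. c \<bullet> z = 0} \<in> null_sets lborel"
proof -
  have "negligible {z. c \<bullet> z = 0}"
    using assms by (intro negligible_hyperplane) auto
  moreover have "closed {z. c \<bullet> z = 0}"
    by (rule closed_hyperplane)
  ultimately show ?thesis
    by (simp add: negligible_iff_null_sets null_sets_completion_iff borel_closed)
qed

lemma AE_lborel_norm_neq: "AE z in lborel. norm (z::complex) \<noteq> r"
proof -
  have "negligible (sphere (0::complex) r)"
    by (rule negligible_sphere)
  then have "sphere (0::complex) r \<in> null_sets lborel"
    by (simp add: negligible_iff_null_sets null_sets_completion_iff borel_closed)
  from AE_not_in[OF this] show ?thesis
    by (auto elim: eventually_mono)
qed

definition arc_sector :: "complex set \<Rightarrow> complex set" where
  "arc_sector I = {z. \<exists>t. z = complex_of_real (norm z) * cis t \<and> \<bar>t - arc_mid I\<bar> \<le> pi * arc_len I}"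

lemma Qbox_iff: "z \<in> Qbox I \<longleftrightarrow> norm z < 1 \<and> 1 - norm z \<le> arc_len I \<and> z \<in> arc_sector I"
  by (simp add: Qbox_def arc_sector_def)

lemma Tbox_iff: "z \<in> Tbox I \<longleftrightarrow> z \<in> Qbox I \<and> arc_len I / 2 \<le> 1 - norm z"
  by (auto simp: Qbox_def Tbox_def)

lemma Tbox_subset_Qbox: "Tbox I \<subseteq> Qbox I"
  by (auto simp: Tbox_iff)

lemma Qbox_subset_ball: "Qbox I \<subseteq> ball 0 1"
  by (auto simp: Qbox_iff)

text \<open>Arcs may be open, closed or half-open, so the closed sector and the arc can disagree on
  the two bounding rays; each ray lies on a line through 0. The form \<open>sgn z \<in> I\<close> is
  free of the chosen midpoint, so inclusions between arcs pass to boxes.\<close>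

lemma AE_arc_sector:
  assumes "is_arc I"
  shows "AE z in lborel. z \<in> arc_sector I \<longleftrightarrow> sgn z \<in> I"
proof -
  define a l where "a = arc_mid I - pi * arc_len I" and "l = arc_len I"
  have rep: "arc_rep I a l"
    using arc_rep_arc_mid[OF assms] by (simp add: a_def l_def)
  \<comment> \<open>\<open>\<i> * cis b\<close> is normal to the line that carries the ray of angle
    b; avoiding this line also excludes z = 0.\<close>
  have "AE z in lborel. (\<i> * cis b) \<bullet> z \<noteq> 0" for b
    using AE_not_in[OF null_sets_lborel_line[of "\<i> * cis b"]] by auto
  from this[of a] this[of "a + 2 * pi * l"] show ?thesis
  proof eventually_elim
    case (elim z)
    have z: "z \<noteq> 0"
      using elim by auto
    have ray: "z \<noteq> of_real r * cis b" if "b = a \<or> b = a + 2 * pi * l" for r b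
      using elim that by (auto simp: inner_complex_def)
    have "sgn z \<in> I" if t: "z = of_real (norm z) * cis t" "\<bar>t - arc_mid I\<bar> \<le> pi * arc_len I" for t
    proof -
      have "a \<le> t" "t \<le> a + 2 * pi * l"
        using t(2) by (auto simp: a_def l_def abs_le_iff)
      moreover have "t \<noteq> a" "t \<noteq> a + 2 * pi * l"
        using ray[of t "norm z"] t(1) by auto
      moreover have "sgn z = cis t"
        using z t(1) by (metis sgn_eq nonzero_mult_div_cancel_left norm_eq_zero of_real_eq_0_iff)
      ultimately show ?thesis
        using rep by (auto simp: arc_rep_def)
    qed
    moreover have "z \<in> arc_sector I" if "sgn z \<in> I"
    proof -
      have "sgn z \<in> cis ` {a..a + 2 * pi * l}"
        using rep that by (auto simp: arc_rep_def)
      then obtain t where t: "sgn z = cis t" "a \<le> t" "t \<le> a + 2 * pi * l"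
        by auto
      have "z = of_real (norm z) * cis t"
        using z by (simp add: sgn_eq flip: t(1))
      moreover have "\<bar>t - arc_mid I\<bar> \<le> pi * arc_len I"
        using t(2,3) by (auto simp: a_def l_def abs_le_iff)
      ultimately show ?thesis
        by (auto simp: arc_sector_def)
    qed
    ultimately show ?case
      by (auto simp: arc_sector_def)
  qed
qed

lemma AE_Qbox:
  assumes "is_arc I"
  shows "AE z in lborel. z \<in> Qbox I \<longleftrightarrow> norm z < 1 \<and> 1 - norm z \<le> arc_len I \<and> sgn z \<in> I"
  using AE_arc_sector[OF assms] by (auto simp: Qbox_iff elim: eventually_mono)

text \<open>The box is the open disc intersected with the image of a compact polar rectangle; radii
  are cut off below at 0 so that they are the norms of the image points.\<close>

lemma Qbox_sets [measurable]: "Qbox I \<in> sets borel"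
proof -
  let ?R = "{1 - arc_len I..1} \<inter> {0..}" and ?A = "{arc_mid I - pi * arc_len I..arc_mid I + pi * arc_len I}"
  have "Qbox I = ball 0 1 \<inter> (\<lambda>(r, t). of_real r * cis t) ` (?R \<times> ?A)"
  proof (intro set_eqI iffI)
    fix z assume "z \<in> Qbox I"
    then obtain t where "norm z < 1" "1 - norm z \<le> arc_len I" "z = of_real (norm z) * cis t"
      "\<bar>t - arc_mid I\<bar> \<le> pi * arc_len I"
      by (auto simp: Qbox_iff arc_sector_def)
    then show "z \<in> ball 0 1 \<inter> (\<lambda>(r, t). of_real r * cis t) ` (?R \<times> ?A)"
      by (auto intro!: rev_image_eqI[of "(norm z, t)"] simp: abs_le_iff)
  next
    fix z assume "z \<in> ball 0 1 \<inter> (\<lambda>(r, t). of_real r * cis t) ` (?R \<times> ?A)"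
    then show "z \<in> Qbox I"
      by (auto simp: Qbox_iff arc_sector_def norm_mult abs_le_iff intro!: exI)
  qed
  moreover have "compact ((\<lambda>(r, t). of_real r * cis t) ` (?R \<times> ?A))"
    by (intro compact_continuous_image compact_Times compact_Int_closed)
       (auto simp: case_prod_unfold intro!: continuous_intros)
  ultimately show ?thesis
    by (metis sets.Int borel_open open_ball borel_compact)
qed

lemma Tbox_sets [measurable]: "Tbox I \<in> sets borel"
proof -
  have "Tbox I = Qbox I \<inter> {z. arc_len I / 2 \<le> 1 - norm z}"
    by (auto simp: Tbox_iff)
  moreover have "closed {z::complex. arc_len I / 2 \<le> 1 - norm z}"
    by (intro closed_Collect_le continuous_intros)
  ultimately show ?thesis
    by (simp add: borel_closed)
qed

text \<open>Writing x = w (1 + y) with |y| < 1/2, the angle changes by the imaginary part of Ln (1 +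
  y), which is at most 2 |y|.\<close>

lemma polar_form_perturb:
  assumes "w = of_real (norm w) * cis t" "norm (x - w) < norm w / 2"
  obtains t' where "x = of_real (norm x) * cis t'" "\<bar>t' - t\<bar> \<le> 2 * (norm (x - w) / norm w)"
proof -
  have w: "w \<noteq> 0"
    using assms(2) by auto
  define y where "y = (x - w) / w"
  have y: "norm y < 1 / 2" "norm y = norm (x - w) / norm w" "x = w * (1 + y)"
    using assms(2) w by (auto simp: y_def norm_divide field_simps)
  then have "1 + y \<noteq> 0"
    by (metis add_eq_0_iff norm_minus_cancel norm_one less_le_not_le one_le_numeral divide_le_eq_1_pos zero_less_numeral)
  define L where "L = Ln (1 + y)"
  have "x = w * exp L"
    using \<open>1 + y \<noteq> 0\<close> y(3) by (simp add: L_def)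
  also have "\<dots> = of_real (norm w) * cis t * (of_real (exp (Re L)) * cis (Im L))"
    using assms(1) by (simp add: exp_eq_polar)
  also have "\<dots> = of_real (norm w * exp (Re L)) * cis (t + Im L)"
    by (simp flip: cis_mult)
  finally have x: "x = of_real (norm w * exp (Re L)) * cis (t + Im L)" .
  then have "norm x = norm w * exp (Re L)"
    by (simp add: norm_mult)
  moreover have "\<bar>Im L\<bar> \<le> 2 * norm y"
    using abs_Im_le_cmod[of L] norm_Ln_le[OF y(1)] by (simp add: L_def)
  ultimately show thesis
    using that[of "t + Im L"] x y(2) by simp
qed

lemma emeasure_ball_complex: "0 \<le> r \<Longrightarrow> emeasure lborel (ball (c::complex) r) = ennreal (pi * r\<^sup>2)"
  by (simp add: emeasure_ball unit_ball_vol_2)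

text \<open>With l the length of the arc, a point of the box is within l of the circle along its ray
  and within angle pi l of the midpoint, so it lies within (1 + pi) l < 6 l of
  \<open>cis (arc_mid I)\<close>. The constant is the area of the disc of radius 6 l.\<close>

lemma emeasure_Qbox_le:
  assumes "is_arc I"
  shows "emeasure lborel (Qbox I) \<le> ennreal (36 * pi * (arc_len I)\<^sup>2)"
proof -
  let ?l = "arc_len I" and ?m = "arc_mid I"
  have l: "0 < ?l"
    using arc_len_bounds[OF assms] by simp
  have "Qbox I \<subseteq> ball (cis ?m) (6 * ?l)"
  proof
    fix z assume "z \<in> Qbox I"
    then obtain t where z: "norm z < 1" "1 - norm z \<le> ?l" "z = of_real (norm z) * cis t"
      "\<bar>t - ?m\<bar> \<le> pi * ?l"
      by (auto simp: Qbox_iff arc_sector_def)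
    have "norm (z - cis ?m) \<le> norm (z - cis t) + norm (cis t - cis ?m)"
      using norm_triangle_ineq[of "z - cis t" "cis t - cis ?m"] by simp
    also have "norm (z - cis t) = 1 - norm z"
    proof -
      have "z - cis t = of_real (norm z - 1) * cis t"
        using z(3) by (simp add: algebra_simps)
      then have "norm (z - cis t) = \<bar>norm z - 1\<bar>"
        by (metis norm_cis norm_mult norm_of_real mult.right_neutral)
      then show ?thesis
        using z(1) by simp
    qed
    also have "norm (cis t - cis ?m) \<le> \<bar>t - ?m\<bar>"
    proof -
      have "cis t - cis ?m = cis ?m * (cis (t - ?m) - 1)"
        by (simp add: algebra_simps cis_mult)
      then have "norm (cis t - cis ?m) = norm (cis (t - ?m) - 1)"
        by (simp add: norm_mult)
      also have "\<dots> \<le> \<bar>t - ?m\<bar>"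
        using dist_exp_i_1[of "t - ?m"] abs_sin_x_le_abs_x[of "(t - ?m) / 2"] by (simp add: cis_conv_exp)
      finally show ?thesis .
    qed
    also have "1 - norm z + \<bar>t - ?m\<bar> \<le> ?l + pi * ?l"
      using z by auto
    also have "\<dots> < 6 * ?l"
      using l pi_less_4 by simp
    finally show "z \<in> ball (cis ?m) (6 * ?l)"
      by (simp add: dist_norm norm_minus_commute)
  qed
  then have "emeasure lborel (Qbox I) \<le> emeasure lborel (ball (cis ?m) (6 * ?l))"
    by (intro emeasure_mono) auto
  then show ?thesis
    using l by (simp add: emeasure_ball_complex power_mult_distrib mult_ac)
qed

lemma emeasure_Tbox_ge:
  assumes "is_arc I"
  shows "ennreal (pi / 64 * (arc_len I)\<^sup>2) \<le> emeasure lborel (Tbox I)"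
proof -
  let ?l = "arc_len I" and ?m = "arc_mid I"
  have l: "0 < ?l" "?l \<le> 1"
    using arc_len_bounds[OF assms] by auto
  \<comment> \<open>The distance 3l/4 from the circle is halfway between l/2 and l, so a disc of
    radius l/8 has radial room. Since |w| >= 1/4, it turns the angle by at most 2 (l/8) / (1/4) =
    l.\<close>
  define w where "w = of_real (1 - 3 / 4 * ?l) * cis ?m"
  have nw: "norm w = 1 - 3 / 4 * ?l"
    using l unfolding w_def norm_mult norm_of_real by simp
  have "ball w (?l / 8) \<subseteq> Tbox I"
  proof
    fix z assume "z \<in> ball w (?l / 8)"
    then have d: "norm (z - w) < ?l / 8"
      by (simp add: dist_norm norm_minus_commute)
    have r: "norm z < 1 - 5 / 8 * ?l" "1 - 7 / 8 * ?l < norm z"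
      using d nw norm_triangle_ineq2[of z w] norm_triangle_ineq2[of w z] by (auto simp: norm_minus_commute)
    have "norm (z - w) < norm w / 2"
      using d nw l by simp
    moreover have "w = of_real (norm w) * cis ?m"
      by (simp only: nw) (simp only: w_def)
    ultimately obtain t where t: "z = of_real (norm z) * cis t" "\<bar>t - ?m\<bar> \<le> 2 * (norm (z - w) / norm w)"
      by (metis polar_form_perturb)
    have "norm (z - w) / norm w \<le> (?l / 8) / (1 / 4)"
      using d nw l by (intro frac_le) auto
    then have "norm (z - w) / norm w \<le> ?l / 2"
      by simp
    then have "\<bar>t - ?m\<bar> \<le> 1 * ?l"
      using t(2) by linarith
    also have "\<dots> \<le> pi * ?l"
      using l pi_ge_two by (intro mult_right_mono) auto
    finally show "z \<in> Tbox I"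
      using t(1) r l by (auto simp: Tbox_iff Qbox_iff arc_sector_def)
  qed
  then have "emeasure lborel (ball w (?l / 8)) \<le> emeasure lborel (Tbox I)"
    by (intro emeasure_mono) auto
  then show ?thesis
    using l by (simp add: emeasure_ball_complex power_divide)
qed

text \<open>Tripling the arc makes its box contain the disc of radius \<open>(1 - |w|)/2\<close> about each \<open>w \<in> Q\<^sub>I\<close>.\<close>

definition arc_dilate :: "complex set \<Rightarrow> complex set" where
  "arc_dilate I = cis ` {arc_mid I - pi * min 1 (3 * arc_len I)..arc_mid I + pi * min 1 (3 * arc_len I)}"

lemma arc_dilate:
  assumes "is_arc I"
  shows "is_arc (arc_dilate I)" "arc_len (arc_dilate I) = min 1 (3 * arc_len I)"
proof -
  have "arc_rep (arc_dilate I) (arc_mid I - pi * min 1 (3 * arc_len I)) (min 1 (3 * arc_len I))"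
    using arc_len_bounds[OF assms] unfolding arc_rep_def arc_dilate_def
    by (auto intro!: image_mono simp: algebra_simps)
  then show "is_arc (arc_dilate I)" "arc_len (arc_dilate I) = min 1 (3 * arc_len I)"
    by (auto simp: is_arc_def arc_len_eqI)
qed

lemma cis_in_full_turn: "cis t \<in> cis ` {m - pi..m + pi}"
proof -
  define k where "k = \<lfloor>(t - (m - pi)) / (2 * pi)\<rfloor>"
  have "of_int k \<le> (t - (m - pi)) / (2 * pi)" "(t - (m - pi)) / (2 * pi) < of_int k + 1"
    unfolding k_def by linarith+
  then have "t - 2 * pi * k \<in> {m - pi..m + pi}"
    by (auto simp: field_simps)
  moreover have "cis t = cis (t - 2 * pi * k)"
    by (simp flip: cis_divide)
  ultimately show ?thesis
    by blast
qed

lemma AE_ball_subset_Qbox_dilate: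
  assumes "is_arc I" "w \<in> Qbox I"
  shows "AE z in lborel. z \<in> ball w ((1 - norm w) / 2) \<longrightarrow> z \<in> Qbox (arc_dilate I)"
  using AE_Qbox[OF arc_dilate(1)[OF assms(1)]] AE_lborel_norm_neq[of 0]
proof eventually_elim
  case (elim z)
  let ?l = "arc_len I" and ?m = "arc_mid I"
  have l: "0 < ?l" "?l \<le> 1"
    using arc_len_bounds[OF assms(1)] by auto
  obtain t where w: "norm w < 1" "1 - norm w \<le> ?l" "w = of_real (norm w) * cis t" "\<bar>t - ?m\<bar> \<le> pi * ?l"
    using assms(2) by (auto simp: Qbox_iff arc_sector_def)
  show ?case
  proof
    assume "z \<in> ball w ((1 - norm w) / 2)"
    then have d: "norm (z - w) < (1 - norm w) / 2"
      by (simp add: dist_norm norm_minus_commute)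
    have r: "norm z < 1" "1 - norm z < 3 * ?l"
      using d w(1,2) norm_triangle_ineq2[of z w] norm_triangle_ineq2[of w z]
      by (auto simp: norm_minus_commute)
    have "sgn z \<in> arc_dilate I"
    proof (cases "3 * ?l < 1")
      \<comment> \<open>Here |w| > 2/3, so passing from w to z turns the angle by at most 3l/2 <= pi
        l, and the deviation from the midpoint stays below 3 pi l.\<close>
      case True
      then have "norm w > 2 / 3"
        using w(2) by simp
      moreover from this have "norm (z - w) < norm w / 2"
        using d by simp
      ultimately obtain s where s: "z = of_real (norm z) * cis s" "\<bar>s - t\<bar> \<le> 2 * (norm (z - w) / norm w)"
        using polar_form_perturb[OF w(3)] by metis
      have "norm (z - w) / norm w \<le> (?l / 2) / (2 / 3)"
        using d w \<open>norm w > 2 / 3\<close> l by (intro frac_le) auto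
      then have "norm (z - w) / norm w \<le> 3 / 4 * ?l"
        by simp
      then have "\<bar>s - t\<bar> \<le> 2 * ?l"
        using s(2) l by linarith
      also have "\<dots> \<le> pi * ?l"
        using l pi_ge_two by (intro mult_right_mono) auto
      finally have "\<bar>s - ?m\<bar> \<le> 3 * (pi * ?l)"
        using w(4) l pi_gt_zero by (smt (verit) mult_nonneg_nonneg)
      moreover have "sgn z = cis s"
        using elim(2) s(1) by (metis sgn_eq nonzero_mult_div_cancel_left of_real_eq_0_iff)
      ultimately show ?thesis
        using True by (auto simp: arc_dilate_def abs_le_iff algebra_simps)
    next
      case False
      obtain s where "sgn z = cis s"
        using elim(2) by (metis cis_Arg norm_eq_zero)
      then show ?thesis
        using False cis_in_full_turn[of s ?m] by (simp add: arc_dilate_def min_def)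
    qed
    then show "z \<in> Qbox (arc_dilate I)"
      using elim(1) r arc_dilate(2)[OF assms(1)] by auto
  qed
qed

text \<open>Arguing through \<open>AE_Qbox\<close> avoids comparing the midpoints that
  \<open>SOME\<close> picks for the two arcs.\<close>

lemma AE_Qbox_subset_dilate:
  assumes "is_arc I"
  shows "AE z in lborel. z \<in> Qbox I \<longrightarrow> z \<in> Qbox (arc_dilate I)"
  using AE_Qbox[OF assms] AE_Qbox[OF arc_dilate(1)[OF assms]]
proof eventually_elim
  case (elim z)
  have l: "0 < arc_len I" "arc_len I \<le> 1"
    using arc_len_bounds[OF assms] by auto
  have "I \<subseteq> cis ` {arc_mid I - pi * arc_len I..arc_mid I + pi * arc_len I}"
    using arc_rep_arc_mid[OF assms] by (auto simp: arc_rep_def algebra_simps)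
  also have "\<dots> \<subseteq> arc_dilate I"
    unfolding arc_dilate_def using l by (intro image_mono) auto
  finally show ?case
    using elim l arc_dilate(2)[OF assms] by auto
qed

section \<open>Layers of a box\<close>

text \<open>For an arc I of a dyadic grid and up to null sets, the n-th tail is covered by the boxes
  of the arcs n generations below I, and the n-th layer is the union of the top halves of those
  boxes.\<close>

definition box_tail :: "complex set \<Rightarrow> nat \<Rightarrow> complex set" where
  "box_tail I n = {z \<in> Qbox I. 1 - norm z \<le> arc_len I / 2 ^ n}"

definition box_layer :: "complex set \<Rightarrow> nat \<Rightarrow> complex set" where
  "box_layer I n = box_tail I n - box_tail I (Suc n)"

lemma box_tail_sets [measurable]: "box_tail I n \<in> sets borel"
proof -
  have "closed {z::complex. 1 - norm z \<le> arc_len I / 2 ^ n}"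
    by (intro closed_Collect_le continuous_intros)
  moreover have "box_tail I n = Qbox I \<inter> {z. 1 - norm z \<le> arc_len I / 2 ^ n}"
    by (auto simp: box_tail_def)
  ultimately show ?thesis
    by (simp add: borel_closed)
qed

lemma box_layer_sets [measurable]: "box_layer I n \<in> sets borel"
  by (simp add: box_layer_def)

lemma box_tail_0 [simp]: "box_tail I 0 = Qbox I"
  by (auto simp: box_tail_def Qbox_iff)

lemma box_tail_Suc_subset:
  assumes "is_arc I"
  shows "box_tail I (Suc n) \<subseteq> box_tail I n"
proof -
  have "arc_len I / 2 ^ Suc n \<le> arc_len I / 2 ^ n"
    using arc_len_bounds[OF assms] by (simp add: field_simps)
  then show ?thesis
    by (auto simp: box_tail_def)
qed

lemma UN_box_layer:
  assumes "is_arc I"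
  shows "(\<Union>n. box_layer I n) = Qbox I" "disjoint_family (box_layer I)"
proof -
  have dec: "box_tail I n \<subseteq> box_tail I m" if "m \<le> n" for m n
    using lift_Suc_antimono_le[of "box_tail I"] box_tail_Suc_subset[OF assms] that by blast
  show "disjoint_family (box_layer I)"
    unfolding disjoint_family_on_def
  proof (intro ballI impI)
    fix m n :: nat assume "m \<noteq> n"
    then consider "Suc m \<le> n" | "Suc n \<le> m" by linarith
    then show "box_layer I m \<inter> box_layer I n = {}"
      by cases (use dec in \<open>fastforce simp: box_layer_def\<close>)+
  qed
  have "z \<in> (\<Union>n. box_layer I n)" if "z \<in> Qbox I" for z
  proof -
    have "0 < 1 - norm z"
      using that by (simp add: Qbox_iff)
    then obtain N where "arc_len I * (1 / 2) ^ N < 1 - norm z"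
      using real_arch_pow_inv[of "(1 - norm z) / arc_len I" "1 / 2"] arc_len_bounds[OF assms]
      by (auto simp: field_simps)
    then have "z \<notin> box_tail I N"
      by (auto simp: box_tail_def power_divide)
    moreover have "z \<in> box_tail I n" if "z \<notin> (\<Union>n. box_layer I n)" for n
      using that \<open>z \<in> Qbox I\<close> by (induction n) (auto simp: box_layer_def)
    ultimately show ?thesis
      by blast
  qed
  then show "(\<Union>n. box_layer I n) = Qbox I"
    by (auto simp: box_layer_def box_tail_def)
qed

section \<open>Generations of a dyadic grid and decay of mass\<close>

lemma dyadic_gridD:
  assumes "dyadic_grid \<D>"
  shows dyadic_grid_is_arc: "I \<in> \<D> \<Longrightarrow> is_arc I"
    and dyadic_grid_null: "I \<in> \<D> \<Longrightarrow> J \<in> \<D> \<Longrightarrow> I \<noteq> J \<Longrightarrow> Tbox I \<inter> Tbox J \<in> null_sets lborel"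
    and dyadic_grid_children: "I \<in> \<D> \<Longrightarrow> \<exists>S\<subseteq>\<D>. finite S \<and> card S = 2 ^ k \<and>
          (\<forall>J\<in>S. arc_len J = arc_len I / 2 ^ k) \<and> \<Union> S = I"
  using assms unfolding dyadic_grid_def by simp_all

text \<open>\<open>S n\<close> consists of arcs n generations below I whose union is I. The sum of
  indicators records at once that the top halves fill the layer and that their overlaps are null,
  and it can be integrated termwise.\<close>

lemma dyadic_grid_layers:
  assumes "dyadic_grid \<D>" "I \<in> \<D>"
  obtains S where "\<And>n. S n \<subseteq> \<D>" "\<And>n. finite (S n)"
    "\<And>n K. K \<in> S n \<Longrightarrow> arc_len K = arc_len I / 2 ^ n"
    "\<And>n. AE z in lborel. indicator (box_layer I n) z = (\<Sum>K\<in>S n. indicator (Tbox K) z :: ennreal)"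
    "\<And>n. AE z in lborel. z \<in> box_tail I n \<longrightarrow> (\<exists>K\<in>S n. z \<in> Qbox K)"
proof -
  have arc: "is_arc K" if "K \<in> \<D>" for K
    using dyadic_grid_is_arc[OF assms(1) that] .
  have "\<forall>n. \<exists>S. S \<subseteq> \<D> \<and> finite S \<and> card S = 2 ^ n \<and> (\<forall>J\<in>S. arc_len J = arc_len I / 2 ^ n) \<and> \<Union> S = I"
    using dyadic_grid_children[OF assms] by simp
  then obtain S where S: "\<And>n. S n \<subseteq> \<D>" "\<And>n. finite (S n)" "\<And>n. \<Union> (S n) = I"
    "\<And>n K. K \<in> S n \<Longrightarrow> arc_len K = arc_len I / 2 ^ n"
    by metis
  have AE_Q: "AE z in lborel. \<forall>K\<in>S n. z \<in> Qbox K \<longleftrightarrow> norm z < 1 \<and> 1 - norm z \<le> arc_len K \<and> sgn z \<in> K" for n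
    using S(1)[of n] arc by (intro AE_ball_countable[THEN iffD2] countable_finite S(2) ballI AE_Qbox) auto
  have AE_disj: "AE z in lborel. \<forall>K\<in>S n. \<forall>J\<in>S n. K \<noteq> J \<longrightarrow> z \<notin> Tbox K \<inter> Tbox J" for n
  proof -
    have "AE z in lborel. K \<noteq> J \<longrightarrow> z \<notin> Tbox K \<inter> Tbox J" if "K \<in> S n" "J \<in> S n" for K J
    proof (cases "K = J")
      case False
      then have "Tbox K \<inter> Tbox J \<in> null_sets lborel"
        using dyadic_grid_null[OF assms(1)] S(1) that by blast
      from AE_not_in[OF this] show ?thesis
        by eventually_elim simp
    qed simp
    then show ?thesis
      using S(2)[of n] by (simp add: AE_ball_countable countable_finite)
  qed
  have "AE z in lborel. z \<in> box_tail I n \<longrightarrow> (\<exists>K\<in>S n. z \<in> Qbox K)" for n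
    using AE_Q[of n] AE_Qbox[OF arc[OF assms(2)]]
  proof eventually_elim
    case (elim z)
    then show ?case
      using S(3)[of n] S(4)[of _ n] by (fastforce simp: box_tail_def)
  qed
  \<comment> \<open>The circle at distance arc_len I / 2^(n+1) from the boundary belongs to the
    closed top halves but not to layer n, so it is discarded.\<close>
  moreover have "AE z in lborel. indicator (box_layer I n) z = (\<Sum>K\<in>S n. indicator (Tbox K) z :: ennreal)" for n
    using AE_Q[of n] AE_Qbox[OF arc[OF assms(2)]] AE_disj[of n] AE_lborel_norm_neq[of "1 - arc_len I / 2 ^ Suc n"]
  proof eventually_elim
    case (elim z)
    have half: "arc_len K / 2 = arc_len I / 2 ^ Suc n" "arc_len K \<le> arc_len I" if "K \<in> S n" for K
    proof -
      have "arc_len I / 2 ^ n \<le> arc_len I / 1"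
        using arc_len_bounds[OF arc[OF assms(2)]] by (intro divide_left_mono) auto
      then show "arc_len K / 2 = arc_len I / 2 ^ Suc n" "arc_len K \<le> arc_len I"
        using S(4)[OF that] by auto
    qed
    show ?case
    proof (cases "z \<in> box_layer I n")
      case True
      then have z: "norm z < 1" "sgn z \<in> I" "1 - norm z \<le> arc_len I / 2 ^ n" "arc_len I / 2 ^ Suc n < 1 - norm z"
        using elim(2) by (auto simp: box_layer_def box_tail_def)
      then obtain K where K: "K \<in> S n" "sgn z \<in> K"
        using S(3)[of n] by auto
      then have "z \<in> Tbox K"
        using z elim(1) S(4)[OF K(1)] half[OF K(1)] by (auto simp: Tbox_iff)
      then have "(\<Sum>J\<in>S n. indicator (Tbox J) z :: ennreal) = (\<Sum>J\<in>{K}. 1)"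
        using elim(3) K(1) S(2) by (intro sum.mono_neutral_cong_right) (auto simp: indicator_def)
      then show ?thesis
        using True by simp
    next
      case False
      have "z \<notin> Tbox K" if K: "K \<in> S n" for K
      proof
        assume T: "z \<in> Tbox K"
        then have "norm z < 1" "1 - norm z \<le> arc_len K" "sgn z \<in> K" "arc_len K / 2 \<le> 1 - norm z"
          using elim(1) K by (auto simp: Tbox_iff)
        then have "z \<in> box_layer I n"
          using elim(2,4) S(3)[of n] S(4)[OF K] half[OF K] K
          by (auto simp: box_layer_def box_tail_def)
        with False show False by simp
      qed
      then show ?thesis
        using False by simp
    qed
  qed
  ultimately show thesis
    by (intro that[OF S(1,2,4)])
qed

lemma nn_integral_box_layer:
  assumes "\<And>n. finite (S n)"
    "AE z in lborel. indicator (box_layer I n) z = (\<Sum>K\<in>S n. indicator (Tbox K) z :: ennreal)"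
    and [measurable]: "k \<in> borel_measurable borel"
  shows "(\<integral>\<^sup>+z\<in>box_layer I n. k z \<partial>lborel) = (\<Sum>K\<in>S n. \<integral>\<^sup>+z\<in>Tbox K. k z \<partial>lborel)"
proof -
  have "(\<integral>\<^sup>+z\<in>box_layer I n. k z \<partial>lborel) = (\<integral>\<^sup>+z. (\<Sum>K\<in>S n. k z * indicator (Tbox K) z) \<partial>lborel)"
    using assms(2) by (intro nn_integral_cong_AE) (auto simp: sum_distrib_left elim!: eventually_mono)
  also have "\<dots> = (\<Sum>K\<in>S n. \<integral>\<^sup>+z\<in>Tbox K. k z \<partial>lborel)"
    by (rule nn_integral_sum) measurable
  finally show ?thesis .
qed

lemma nn_integral_Qbox_layers:
  assumes "is_arc I" and [measurable]: "k \<in> borel_measurable borel"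
  shows "(\<integral>\<^sup>+z\<in>Qbox I. k z \<partial>lborel) = (\<Sum>n. \<integral>\<^sup>+z\<in>box_layer I n. k z \<partial>lborel)"
proof -
  have "(\<integral>\<^sup>+z\<in>Qbox I. k z \<partial>lborel) = (\<integral>\<^sup>+z. (\<Sum>n. k z * indicator (box_layer I n) z) \<partial>lborel)"
    using suminf_indicator[OF UN_box_layer(2)[OF assms(1)]] UN_box_layer(1)[OF assms(1)]
    by (simp add: ennreal_suminf_cmult)
  also have "\<dots> = (\<Sum>n. \<integral>\<^sup>+z\<in>box_layer I n. k z \<partial>lborel)"
    by (rule nn_integral_suminf) measurable
  finally show ?thesis .
qed

text \<open>Let r n and a n be the masses of the n-th tail and layer. Applying \<open>top\<close> to
  every box of generation n gives r n <= A a n, hence r (n + 1) = r n - a n <= (1 - 1/A) r n.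
  Finiteness of the total mass permits the subtraction.\<close>

lemma nn_integral_box_layer_decay:
  fixes k :: "complex \<Rightarrow> ennreal"
  assumes grid: "dyadic_grid \<D>" and I: "I \<in> \<D>" and [measurable]: "k \<in> borel_measurable borel"
    and fin: "(\<integral>\<^sup>+z\<in>Qbox I. k z \<partial>lborel) < \<infinity>"
    and top: "\<And>K. K \<in> \<D> \<Longrightarrow> (\<integral>\<^sup>+z\<in>Qbox K. k z \<partial>lborel) \<le> ennreal A * (\<integral>\<^sup>+z\<in>Tbox K. k z \<partial>lborel)"
    and A: "1 \<le> A"
  shows "(\<integral>\<^sup>+z\<in>box_layer I n. k z \<partial>lborel) \<le> ennreal ((1 - 1 / A) ^ n) * (\<integral>\<^sup>+z\<in>Qbox I. k z \<partial>lborel)"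
proof -
  have arc: "is_arc I"
    using dyadic_grid_is_arc[OF grid I] .
  obtain S where S: "\<And>n. S n \<subseteq> \<D>" "\<And>n. finite (S n)"
    "\<And>n K. K \<in> S n \<Longrightarrow> arc_len K = arc_len I / 2 ^ n"
    "\<And>n. AE z in lborel. indicator (box_layer I n) z = (\<Sum>K\<in>S n. indicator (Tbox K) z :: ennreal)"
    "\<And>n. AE z in lborel. z \<in> box_tail I n \<longrightarrow> (\<exists>K\<in>S n. z \<in> Qbox K)"
    by (rule dyadic_grid_layers[OF grid I]) (rule that, assumption+)
  define a where "a n = (\<integral>\<^sup>+z\<in>box_layer I n. k z \<partial>lborel)" for n
  define r where "r n = (\<integral>\<^sup>+z\<in>box_tail I n. k z \<partial>lborel)" for n
  have r_split: "r n = a n + r (Suc n)" for n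
  proof -
    have "r n = (\<integral>\<^sup>+z. k z * indicator (box_layer I n) z + k z * indicator (box_tail I (Suc n)) z \<partial>lborel)"
      unfolding r_def using box_tail_Suc_subset[OF arc, of n]
      by (intro nn_integral_cong) (auto simp: indicator_def box_layer_def)
    then show ?thesis
      by (simp add: nn_integral_add a_def r_def)
  qed
  have r_le: "r n \<le> ennreal A * a n" for n
  proof -
    have "r n \<le> (\<integral>\<^sup>+z. (\<Sum>K\<in>S n. k z * indicator (Qbox K) z) \<partial>lborel)"
      unfolding r_def
    proof (rule nn_integral_mono_AE, use S(5)[of n] in eventually_elim)
      case (elim z)
      show ?case
      proof (cases "z \<in> box_tail I n")
        case True
        then obtain K where K: "K \<in> S n" "z \<in> Qbox K"
          using elim by auto
        then have "k z * indicator (Qbox K) z \<le> (\<Sum>K\<in>S n. k z * indicator (Qbox K) z)"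
          using S(2) by (intro member_le_sum) auto
        then show ?thesis
          using True K by simp
      qed simp
    qed
    also have "\<dots> = (\<Sum>K\<in>S n. \<integral>\<^sup>+z\<in>Qbox K. k z \<partial>lborel)"
      by (rule nn_integral_sum) measurable
    also have "\<dots> \<le> (\<Sum>K\<in>S n. ennreal A * (\<integral>\<^sup>+z\<in>Tbox K. k z \<partial>lborel))"
      using top S(1) by (intro sum_mono) auto
    also have "\<dots> = ennreal A * a n"
      unfolding a_def by (subst nn_integral_box_layer[OF S(2,4)]) (auto simp: sum_distrib_left)
    finally show ?thesis .
  qed
  have r0: "r 0 = (\<integral>\<^sup>+z\<in>Qbox I. k z \<partial>lborel)"
    by (simp add: r_def)
  have fin_r: "r n < \<infinity>" for n
  proof (induction n)
    case (Suc n)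
    then show ?case
      using r_split[of n] by (simp add: less_top)
  qed (use fin r0 in simp)
  have fin_a: "a n < \<infinity>" for n
    using fin_r[of n] r_split[of n] by (simp add: less_top)
  define ra rr where "ra n = enn2real (a n)" and "rr n = enn2real (r n)" for n
  have ar: "a n = ennreal (ra n)" "r n = ennreal (rr n)" "0 \<le> ra n" "0 \<le> rr n" for n
    using fin_a[of n] fin_r[of n] by (auto simp: ra_def rr_def)
  have split: "rr n = ra n + rr (Suc n)" for n
    using r_split[of n] ar by (metis enn2real_ennreal ennreal_plus add_nonneg_nonneg)
  have le: "rr n \<le> A * ra n" for n
    using r_le[of n] ar A by (metis ennreal_le_iff ennreal_mult' mult_nonneg_nonneg order_trans zero_le_one)
  have "rr n \<le> (1 - 1 / A) ^ n * rr 0" for n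
  proof (induction n)
    case (Suc n)
    have "rr (Suc n) \<le> (1 - 1 / A) * rr n"
      using split[of n] le[of n] A by (simp add: field_simps)
    also have "\<dots> \<le> (1 - 1 / A) * ((1 - 1 / A) ^ n * rr 0)"
      using A Suc by (intro mult_left_mono) auto
    finally show ?case
      by (simp add: mult.assoc)
  qed simp
  then have "ra n \<le> (1 - 1 / A) ^ n * rr 0"
    using split[of n] ar(4)[of "Suc n"] by (metis add_increasing2 order_refl order_trans)
  then have "a n \<le> ennreal ((1 - 1 / A) ^ n) * r 0"
    unfolding ar using A ar by (simp flip: ennreal_mult)
  then show ?thesis
    by (simp add: a_def r0)
qed

section \<open>Higher integrability\<close>

text \<open>Split at the threshold \<tau>: above it, x^(1 - q) is at most \<tau>^(1 - q).\<close>

lemma le_add_powr_mult: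
  fixes x \<tau> q :: real
  assumes "0 < x" "0 < \<tau>" "1 \<le> q"
  shows "x \<le> \<tau> + x powr q * \<tau> powr (1 - q)"
proof (cases "x \<le> \<tau>")
  case True
  have "0 \<le> x powr q * \<tau> powr (1 - q)" by simp
  with True show ?thesis by linarith
next
  case False
  have "x = x powr q * x powr (1 - q)"
    using assms by (simp flip: powr_add)
  also have "\<dots> \<le> x powr q * \<tau> powr (1 - q)"
    using False assms by (intro mult_left_mono powr_mono2') auto
  finally show ?thesis
    using assms(2) by linarith
qed

text \<open>The threshold y^(-1/(q-1)) is the one whose power 1 - q equals y. This Young-type
  inequality does the work of Hoelder's inequality in a form that can be summed over boxes.\<close>

lemma le_powr_mult_add:
  fixes x y q :: real
  assumes "0 < x" "0 < y" "1 < q"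
  shows "x \<le> x powr q * y + y powr (- (1 / (q - 1)))"
proof -
  have "(y powr (- (1 / (q - 1)))) powr (1 - q) = y"
  proof -
    have "- (1 / (q - 1)) * (1 - q) = 1"
      using assms by (simp add: field_simps)
    then show ?thesis
      using assms unfolding powr_powr by simp
  qed
  then show ?thesis
    using le_add_powr_mult[of x "y powr (- (1 / (q - 1)))" q] assms by simp
qed

text \<open>F, V, L belong to a box I and FK, VK, LK to a descendant K: mass of h^q0 v, reference
  mass and squared length. In the proof, x compares the q0-means FK / VK and F / V, y compares the
  densities VK / LK and V / L, and Young's inequality separates them. The first term is proportional
  to FK, whose sum over a layer decays; the second is designed to be summed as an integral of
  v^(-1/(q-1)), which B_q controls.\<close>

lemma box_ratio_bound:
  fixes F V L FK VK LK T :: real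
  assumes pos: "0 < FK" "0 < VK" "0 < V" "0 < LK" "0 < L" and le: "FK \<le> F" "V \<le> T * VK"
    and q: "1 \<le> q0" "0 < \<epsilon>" "q = q0 * (1 + \<epsilon>)"
  shows "(FK / VK) powr (1 / q0) * LK \<le> (F / V) powr (1 / q0) *
    (L * T powr \<epsilon> * (FK / F) + (V / L) powr (1 / (q - 1)) * ((VK / LK) powr (- (1 / (q - 1))) * LK))"
proof -
  have F: "0 < F" and "0 < T * VK"
    using pos le by linarith+
  then have T: "0 < T"
    using pos(2) zero_less_mult_pos2 by blast
  have "1 < 1 + \<epsilon>"
    using q by simp
  also have "\<dots> \<le> q"
    using q mult_right_mono[of 1 q0 "1 + \<epsilon>"] by simp
  finally have q1: "1 < q" .
  define x where "x = ((FK / F) * (V / VK)) powr (1 / q0)"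
  define y where "y = (VK / V) * (L / LK)"
  have xy: "0 < x" "0 < y"
    using pos F by (auto simp: x_def y_def)
  have "(FK / VK) powr (1 / q0) = (F / V * ((FK / F) * (V / VK))) powr (1 / q0)"
    using pos F by (simp add: field_simps)
  also have "\<dots> = (F / V) powr (1 / q0) * x"
    unfolding x_def by (rule powr_mult)
  finally have 1: "(FK / VK) powr (1 / q0) * LK = (F / V) powr (1 / q0) * (x * LK)"
    by simp
  \<comment> \<open>Since q / q0 = 1 + \<epsilon>, the factor V / VK in x^q cancels against y except
    for its power \<epsilon>, which costs T^\<epsilon>.\<close>
  have "x powr q = ((FK / F) * (V / VK)) powr (1 + \<epsilon>)"
    using q unfolding x_def by (simp add: powr_powr)
  also have "\<dots> = (FK / F) * (V / VK) * ((FK / F) powr \<epsilon> * (V / VK) powr \<epsilon>)"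
    using pos F by (simp only: powr_add powr_mult) simp
  finally have "x powr q * y * LK = L * ((FK / F) powr \<epsilon> * (V / VK) powr \<epsilon>) * (FK / F)"
    using pos F by (simp add: y_def field_simps)
  also have "\<dots> \<le> L * (1 * T powr \<epsilon>) * (FK / F)"
  proof (intro mult_right_mono mult_left_mono mult_mono)
    show "(FK / F) powr \<epsilon> \<le> 1"
      using pos F le q by (intro powr_le1) auto
    show "(V / VK) powr \<epsilon> \<le> T powr \<epsilon>"
      using pos le q by (intro powr_mono2) (auto simp: field_simps)
  qed (use pos F in auto)
  finally have 2: "x powr q * y * LK \<le> L * T powr \<epsilon> * (FK / F)"
    by simp
  have "y = inverse (V / L) * (VK / LK)"
    by (simp add: y_def field_simps)
  then have "y powr (- (1 / (q - 1))) = inverse (V / L) powr (- (1 / (q - 1))) * (VK / LK) powr (- (1 / (q - 1)))"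
    using pos by (simp only: powr_mult) 
  also have "inverse (V / L) powr (- (1 / (q - 1))) = (V / L) powr (1 / (q - 1))"
    using pos by (simp add: powr_minus powr_divide field_simps)
  finally have 3: "y powr (- (1 / (q - 1))) * LK = (V / L) powr (1 / (q - 1)) * ((VK / LK) powr (- (1 / (q - 1))) * LK)"
    by simp
  have "x * LK \<le> (x powr q * y + y powr (- (1 / (q - 1)))) * LK"
    using le_powr_mult_add[OF xy q1] pos by (intro mult_right_mono) auto
  also have "\<dots> \<le> L * T powr \<epsilon> * (FK / F) + (V / L) powr (1 / (q - 1)) * ((VK / LK) powr (- (1 / (q - 1))) * LK)"
    unfolding distrib_right 3 using 2 by (rule add_right_mono)
  finally show ?thesis
    unfolding 1 by (intro mult_left_mono) auto
qed

lemma emeasure_Tbox_le: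
  assumes "is_arc I"
  shows "emeasure lborel (Tbox I) \<le> ennreal (36 * pi * (arc_len I)\<^sup>2)"
proof -
  have "emeasure lborel (Tbox I) \<le> emeasure lborel (Qbox I)"
    by (intro emeasure_mono Tbox_subset_Qbox) simp
  then show ?thesis
    using emeasure_Qbox_le[OF assms] by (rule order_trans)
qed

lemma not_AE_not_in_Tbox:
  assumes "is_arc I"
  shows "\<not> (AE z in lborel. z \<notin> Tbox I)"
proof
  assume "AE z in lborel. z \<notin> Tbox I"
  then have "Tbox I \<in> null_sets lborel"
    by (simp add: AE_iff_null_sets)
  then have "emeasure lborel (Tbox I) = 0"
    by auto
  moreover have "0 < pi * (arc_len I)\<^sup>2"
    using arc_len_bounds[OF assms] by simp
  ultimately show False
    using emeasure_Tbox_ge[OF assms] by (simp add: ennreal_eq_0_iff)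
qed

lemma nn_integral_Tbox_pos:
  fixes k :: "complex \<Rightarrow> real"
  assumes "is_arc I" and [measurable]: "k \<in> borel_measurable borel" and pos: "\<And>z. 0 < k z"
  shows "0 < (\<integral>\<^sup>+z\<in>Tbox I. ennreal (k z) \<partial>lborel)"
proof (rule ccontr)
  assume "\<not> ?thesis"
  then have "(\<integral>\<^sup>+z\<in>Tbox I. ennreal (k z) \<partial>lborel) = 0"
    by simp
  then have "AE z in lborel. ennreal (k z) * indicator (Tbox I) z = 0"
    by (subst (asm) nn_integral_0_iff_AE) auto
  then have "AE z in lborel. z \<notin> Tbox I"
    by eventually_elim (metis ennreal_eq_0_iff indicator_simps(1) mult.right_neutral not_le pos)
  then show False
    using not_AE_not_in_Tbox[OF assms(1)] by simp
qed

text \<open>\<open>V I\<close> stands for a mass of \<open>v\<close> near Q_I and will be the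
  integral over the dilated box. The upper bound is asked on the top half; the lower bound holds on
  all of Q_I at the price of a power of the distance to the circle, and this price sets the growth
  rate from one generation to the next.\<close>

locale grid_weight =
  fixes \<D> :: "complex set set" and v :: "complex \<Rightarrow> real" and V :: "complex set \<Rightarrow> real" and C b :: real
  assumes grid: "dyadic_grid \<D>"
    and v_measurable [measurable]: "v \<in> borel_measurable borel"
    and v_pos: "0 < v z"
    and C_ge_1: "1 \<le> C" and b_nonneg: "0 \<le> b"
    and V_pos: "I \<in> \<D> \<Longrightarrow> 0 < V I"
    and v_le_V: "I \<in> \<D> \<Longrightarrow> z \<in> Tbox I \<Longrightarrow> (arc_len I)\<^sup>2 * v z \<le> C * V I"
    and V_le_v: "I \<in> \<D> \<Longrightarrow> z \<in> Qbox I \<Longrightarrow>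
      V I \<le> C * (arc_len I)\<^sup>2 * (arc_len I / (1 - norm z)) powr b * v z"
begin

lemma arc: "I \<in> \<D> \<Longrightarrow> is_arc I"
  by (rule dyadic_grid_is_arc[OF grid])

lemma len_pos: "I \<in> \<D> \<Longrightarrow> 0 < arc_len I"
  using arc_len_bounds[OF arc] by simp

lemma V_le_v_top:
  assumes "I \<in> \<D>" "z \<in> Tbox I"
  shows "V I \<le> C * 2 powr b * (arc_len I)\<^sup>2 * v z"
proof -
  have z: "z \<in> Qbox I" "arc_len I / 2 \<le> 1 - norm z" "norm z < 1"
    using assms(2) by (auto simp: Tbox_iff Qbox_iff)
  then have "(arc_len I / (1 - norm z)) powr b \<le> 2 powr b"
    using len_pos[OF assms(1)] b_nonneg by (intro powr_mono2) (auto simp: field_simps)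
  then have "C * (arc_len I)\<^sup>2 * (arc_len I / (1 - norm z)) powr b * v z \<le> C * (arc_len I)\<^sup>2 * 2 powr b * v z"
    using C_ge_1 less_imp_le[OF v_pos] by (intro mult_right_mono mult_left_mono) auto
  then show ?thesis
    using V_le_v[OF assms(1) z(1)] by (simp add: mult_ac)
qed

text \<open>V I and V K are compared through the value of \<open>v\<close> at one common point w of
  T_K and Q_I. There arc_len I / (1 - |w|) <= 2 * 2^n, and the squared lengths differ by 4^n, whence
  the base \<open>4 * 2 powr b\<close>.\<close>

lemma V_descendant:
  assumes I: "I \<in> \<D>" and K: "K \<in> \<D>" and len: "arc_len K = arc_len I / 2 ^ n"
    and sub: "AE z in lborel. z \<in> Tbox K \<longrightarrow> z \<in> Qbox I"
  shows "V I \<le> C\<^sup>2 * 2 powr b * (4 * 2 powr b) ^ n * V K"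
proof -
  \<comment> \<open>The almost everywhere inclusion yields a common point because T_K has positive
    measure.\<close>
  have "\<not> (\<forall>z. z \<in> Tbox K \<longrightarrow> z \<notin> Qbox I)"
  proof
    assume "\<forall>z. z \<in> Tbox K \<longrightarrow> z \<notin> Qbox I"
    with sub have "AE z in lborel. z \<notin> Tbox K"
      by (auto elim: eventually_mono)
    with not_AE_not_in_Tbox[OF arc[OF K]] show False ..
  qed
  then obtain w where w: "w \<in> Tbox K" "w \<in> Qbox I"
    by blast
  have l: "0 < arc_len I" "0 < arc_len K"
    using len_pos I K by auto
  have "arc_len I / (1 - norm w) \<le> 2 * 2 ^ n"
    using w len l by (auto simp: Tbox_iff Qbox_iff field_simps)
  then have "(arc_len I / (1 - norm w)) powr b \<le> (2 * 2 ^ n) powr b"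
    using w l b_nonneg by (intro powr_mono2) (auto simp: Qbox_iff)
  also have "\<dots> = 2 powr b * (2 powr b) ^ n"
    by (simp add: powr_mult powr_power powr_powr mult.commute flip: powr_realpow)
  finally have "V I \<le> C * (arc_len I)\<^sup>2 * (2 powr b * (2 powr b) ^ n) * v w"
    using V_le_v[OF I w(2)] C_ge_1 less_imp_le[OF v_pos[of w]]
    by (meson mult_left_mono mult_right_mono order_trans zero_le_mult_iff zero_le_one zero_le_power2)
  also have "\<dots> = C * 2 powr b * (4 * 2 powr b) ^ n * ((arc_len K)\<^sup>2 * v w)"
    unfolding len by (simp add: power_mult_distrib power_divide field_simps flip: power_mult)
      (simp add: power_mult mult.commute[of n])
  also have "\<dots> \<le> C * 2 powr b * (4 * 2 powr b) ^ n * (C * V K)"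
    using v_le_V[OF K w(1)] C_ge_1 by (intro mult_left_mono) auto
  finally show ?thesis
    by (simp add: power2_eq_square mult_ac)
qed

text \<open>On T_K the weight is at least a multiple of V K divided by the squared length, so F
  controls the unweighted integral of h^q0; the threshold inequality then passes from h^q0 to
  h.\<close>

lemma nn_integral_top_le:
  fixes h :: "complex \<Rightarrow> real"
  assumes K: "K \<in> \<D>" and [measurable]: "h \<in> borel_measurable borel" and h: "\<And>z. 0 < h z" and q0: "1 \<le> q0"
    and F: "(\<integral>\<^sup>+z\<in>Tbox K. ennreal (h z powr q0 * v z) \<partial>lborel) = ennreal F" "0 < F"
  shows "(\<integral>\<^sup>+z\<in>Tbox K. ennreal (h z) \<partial>lborel)
    \<le> ennreal ((36 * pi + C * 2 powr b) * ((F / V K) powr (1 / q0) * (arc_len K)\<^sup>2))"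
proof -
  \<comment> \<open>With this threshold both terms integrate to a multiple of
    \<open>\<tau> * (arc_len K)\<^sup>2\<close>.\<close>
  define \<tau> where "\<tau> = (F / V K) powr (1 / q0)"
  have \<tau>: "0 < \<tau>"
    using F V_pos[OF K] by (simp add: \<tau>_def)
  define c where "c = \<tau> powr (1 - q0) * (C * 2 powr b * (arc_len K)\<^sup>2 / V K)"
  have c: "0 \<le> c"
    using C_ge_1 V_pos[OF K] by (simp add: c_def)
  have "h z \<le> \<tau> + c * (h z powr q0 * v z)" if z: "z \<in> Tbox K" for z
  proof -
    have "1 \<le> C * 2 powr b * (arc_len K)\<^sup>2 / V K * v z"
      using V_le_v_top[OF K z] V_pos[OF K] by (simp add: field_simps)
    then have "(h z powr q0 * \<tau> powr (1 - q0)) * 1 \<le> (h z powr q0 * \<tau> powr (1 - q0)) * (C * 2 powr b * (arc_len K)\<^sup>2 / V K * v z)"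
      by (intro mult_left_mono) auto
    then show ?thesis
      using le_add_powr_mult[OF h[of z] \<tau> q0] by (simp add: c_def mult_ac)
  qed
  then have "(\<integral>\<^sup>+z\<in>Tbox K. ennreal (h z) \<partial>lborel)
      \<le> (\<integral>\<^sup>+z. ennreal \<tau> * indicator (Tbox K) z + ennreal c * (ennreal (h z powr q0 * v z) * indicator (Tbox K) z) \<partial>lborel)"
    using \<tau> c less_imp_le[OF v_pos] by (intro nn_integral_mono)
      (auto simp: indicator_def ennreal_leI simp flip: ennreal_mult ennreal_plus)
  also have "\<dots> = ennreal \<tau> * emeasure lborel (Tbox K) + ennreal c * ennreal F"
    by (simp add: nn_integral_add nn_integral_cmult F(1))
  also have "\<dots> \<le> ennreal \<tau> * ennreal (36 * pi * (arc_len K)\<^sup>2) + ennreal c * ennreal F"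
    using emeasure_Tbox_le[OF arc[OF K]] by (intro add_mono mult_left_mono) auto
  also have "\<dots> = ennreal (\<tau> * (36 * pi * (arc_len K)\<^sup>2) + c * F)"
    using \<tau> c F(2) by (simp add: ennreal_mult)
  also have "c * F = C * 2 powr b * (\<tau> * (arc_len K)\<^sup>2)"
  proof -
    have "\<tau> powr q0 = F / V K"
      using F V_pos[OF K] q0 by (simp add: \<tau>_def powr_powr)
    moreover have "\<tau> powr (1 - q0) * \<tau> powr q0 = \<tau>"
      using \<tau> by (simp flip: powr_add)
    ultimately have "\<tau> powr (1 - q0) * (F / V K) = \<tau>"
      by simp
    then show ?thesis
      by (simp add: c_def) (metis (no_types, opaque_lifting) mult.commute mult.left_commute times_divide_eq_right)
  qed
  also have "\<tau> * (36 * pi * (arc_len K)\<^sup>2) + C * 2 powr b * (\<tau> * (arc_len K)\<^sup>2)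
      = (36 * pi + C * 2 powr b) * (\<tau> * (arc_len K)\<^sup>2)"
    by (simp add: algebra_simps)
  finally show ?thesis
    by (simp add: \<tau>_def)
qed

text \<open>On T_K the weight is at most C times the density of V, and the power -s reverses this;
  64 / pi comes from the lower bound for the area of T_K. Powers of densities thus become integrals
  over disjoint pieces of one box.\<close>

lemma V_density_powr_le:
  assumes K: "K \<in> \<D>" and s: "0 \<le> s"
  shows "ennreal ((V K / (arc_len K)\<^sup>2) powr (- s) * (arc_len K)\<^sup>2)
    \<le> ennreal (C powr s * 64 / pi) * (\<integral>\<^sup>+z\<in>Tbox K. ennreal (v z powr (- s)) \<partial>lborel)"
proof -
  define d where "d = (V K / (arc_len K)\<^sup>2) powr (- s)"
  have d: "0 \<le> d"
    by (simp add: d_def)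
  have le: "d \<le> C powr s * v z powr (- s)" if z: "z \<in> Tbox K" for z
  proof -
    have "v z / C \<le> V K / (arc_len K)\<^sup>2"
      using v_le_V[OF K z] C_ge_1 len_pos[OF K] by (simp add: field_simps)
    then have "d \<le> (v z / C) powr (- s)"
      unfolding d_def using s v_pos[of z] C_ge_1 by (intro powr_mono2') auto
    also have "\<dots> = C powr s * v z powr (- s)"
      using v_pos[of z] C_ge_1 by (simp add: powr_divide powr_minus field_simps)
    finally show ?thesis .
  qed
  have "ennreal (d * (arc_len K)\<^sup>2) = ennreal (64 / pi * d) * ennreal (pi / 64 * (arc_len K)\<^sup>2)"
    using d by (subst ennreal_mult[symmetric]) (auto simp: field_simps)
  also have "\<dots> \<le> ennreal (64 / pi * d) * emeasure lborel (Tbox K)"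
    by (intro mult_left_mono emeasure_Tbox_ge arc K) auto
  also have "\<dots> = (\<integral>\<^sup>+z\<in>Tbox K. ennreal (64 / pi * d) \<partial>lborel)"
    by (subst nn_integral_cmult_indicator) auto
  also have "\<dots> \<le> (\<integral>\<^sup>+z. ennreal (C powr s * 64 / pi) * (ennreal (v z powr (- s)) * indicator (Tbox K) z) \<partial>lborel)"
    using le d by (intro nn_integral_mono)
      (auto simp: indicator_def field_simps intro!: ennreal_leI simp flip: ennreal_mult)
  also have "\<dots> = ennreal (C powr s * 64 / pi) * (\<integral>\<^sup>+z\<in>Tbox K. ennreal (v z powr (- s)) \<partial>lborel)"
    by (subst nn_integral_cmult) auto
  finally show ?thesis
    by (simp add: d_def)
qed

text \<open>The sum over the boxes below \<open>I\<close> converges because the weighted mass of the \<open>n\<close>-th layer decays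
  like \<open>(1 - 1/A)\<^sup>n\<close>, while \<open>\<epsilon>\<close> is so small that the density ratio \<open>V I / V K\<close> to the
  power \<open>\<epsilon>\<close> grows more slowly.\<close>

lemma nn_integral_Qbox_le:
  fixes h :: "complex \<Rightarrow> real"
  assumes [measurable]: "h \<in> borel_measurable borel" and h: "\<And>z. 0 < h z" and q0: "1 \<le> q0"
    and F: "\<And>I. I \<in> \<D> \<Longrightarrow> (\<integral>\<^sup>+z\<in>Qbox I. ennreal (h z powr q0 * v z) \<partial>lborel) = ennreal (F I)"
    and F_pos: "\<And>I. I \<in> \<D> \<Longrightarrow> 0 < F I"
    and top: "\<And>I. I \<in> \<D> \<Longrightarrow> (\<integral>\<^sup>+z\<in>Qbox I. ennreal (h z powr q0 * v z) \<partial>lborel)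
        \<le> ennreal A * (\<integral>\<^sup>+z\<in>Tbox I. ennreal (h z powr q0 * v z) \<partial>lborel)"
    and Bq: "\<And>q. q0 < q \<Longrightarrow> \<exists>B\<ge>0. \<forall>I\<in>\<D>. (\<integral>\<^sup>+z\<in>Qbox I. ennreal (v z powr (- (1 / (q - 1)))) \<partial>lborel)
        \<le> ennreal (B * (arc_len I)\<^sup>2 * (V I / (arc_len I)\<^sup>2) powr (- (1 / (q - 1))))"
  shows "\<exists>B\<ge>0. \<forall>I\<in>\<D>. (\<integral>\<^sup>+z\<in>Qbox I. ennreal (h z) \<partial>lborel)
        \<le> ennreal (B * (arc_len I)\<^sup>2 * (F I / V I) powr (1 / q0))"
proof -
  define k where "k z = ennreal (h z powr q0 * v z)" for z
  have k [measurable]: "k \<in> borel_measurable borel"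
    unfolding k_def by measurable
  have hv_pos: "0 < h z powr q0 * v z" for z
    using h[of z] v_pos[of z] by simp
  \<comment> \<open>At least 2, so that \<rho> is strictly positive and ln \<rho> is a finite
    negative number.\<close>
  define A' where "A' = max A 2"
  have A': "2 \<le> A'" "A \<le> A'"
    by (auto simp: A'_def)
  have top': "(\<integral>\<^sup>+z\<in>Qbox I. k z \<partial>lborel) \<le> ennreal A' * (\<integral>\<^sup>+z\<in>Tbox I. k z \<partial>lborel)" if "I \<in> \<D>" for I
    using top[OF that] A'(2) unfolding k_def by (meson ennreal_leI mult_right_mono order_trans zero_le)
  define \<rho> where "\<rho> = 1 - 1 / A'"
  have \<rho>: "0 < \<rho>" "\<rho> < 1"
    using A' by (auto simp: \<rho>_def field_simps)
  \<comment> \<open>The growth factor per generation in \<open>V_descendant\<close>.\<close>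
  define \<theta> where "\<theta> = 4 * 2 powr b"
  have "1 \<le> 2 powr b"
    using b_nonneg by (simp add: ge_one_powr_ge_zero)
  then have \<theta>: "1 < \<theta>"
    by (simp add: \<theta>_def)
  \<comment> \<open>Chosen so that \<theta>^\<epsilon> = \<rho>^(-1/2). The ratio \<eta> of the
    geometric series is then \<rho>^(1/2).\<close>
  define \<epsilon> where "\<epsilon> = - ln \<rho> / (2 * ln \<theta>)"
  have \<epsilon>: "0 < \<epsilon>"
    using \<rho> \<theta> by (auto simp: \<epsilon>_def intro!: divide_neg_pos)
  define \<eta> where "\<eta> = \<rho> * \<theta> powr \<epsilon>"
  have "\<theta> powr \<epsilon> = exp (- ln \<rho> / 2)"
    using \<theta> by (simp add: powr_def \<epsilon>_def field_simps)
  then have "\<eta> = exp (ln \<rho>) * exp (- ln \<rho> / 2)"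
    using \<rho> by (simp add: \<eta>_def)
  also have "\<dots> = exp (ln \<rho> / 2)"
    by (simp flip: exp_add)
  finally have \<eta>: "0 < \<eta>" "\<eta> < 1"
    using \<rho> by auto
  define q where "q = q0 * (1 + \<epsilon>)"
  have "1 + \<epsilon> \<le> q" "q0 < q"
    using q0 \<epsilon> mult_right_mono[of 1 q0 "1 + \<epsilon>"] by (auto simp: q_def)
  define s where "s = 1 / (q - 1)"
  have s: "0 \<le> s"
    using \<open>1 + \<epsilon> \<le> q\<close> \<epsilon> by (simp add: s_def)
  obtain B where B: "0 \<le> B" "\<And>I. I \<in> \<D> \<Longrightarrow> (\<integral>\<^sup>+z\<in>Qbox I. ennreal (v z powr (- s)) \<partial>lborel)
        \<le> ennreal (B * (arc_len I)\<^sup>2 * (V I / (arc_len I)\<^sup>2) powr (- s))"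
    using Bq[OF \<open>q0 < q\<close>] unfolding s_def by auto
  define C1 where "C1 = 36 * pi + C * 2 powr b"
  define C2 where "C2 = C\<^sup>2 * 2 powr b"
  define C3 where "C3 = C powr s * 64 / pi"
  have Cs: "0 \<le> C1" "0 \<le> C2" "0 \<le> C3"
    using C_ge_1 by (auto simp: C1_def C2_def C3_def)
  define B' where "B' = C1 * (C2 powr \<epsilon> / (1 - \<eta>) + C3 * B)"
  have "(\<integral>\<^sup>+z\<in>Qbox I. ennreal (h z) \<partial>lborel) \<le> ennreal (B' * (arc_len I)\<^sup>2 * (F I / V I) powr (1 / q0))"
    if I: "I \<in> \<D>" for I
  proof -
    obtain S where S: "\<And>n. S n \<subseteq> \<D>" "\<And>n. finite (S n)"
      "\<And>n K. K \<in> S n \<Longrightarrow> arc_len K = arc_len I / 2 ^ n"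
      "\<And>n. AE z in lborel. indicator (box_layer I n) z = (\<Sum>K\<in>S n. indicator (Tbox K) z :: ennreal)"
      "\<And>n. AE z in lborel. z \<in> box_tail I n \<longrightarrow> (\<exists>K\<in>S n. z \<in> Qbox K)"
      by (rule dyadic_grid_layers[OF grid I]) (rule that, assumption+)
    define L U where "L = (arc_len I)\<^sup>2" and "U = (F I / V I) powr (1 / q0)"
    have LU: "0 < L" "0 < U"
      using len_pos[OF I] F_pos[OF I] V_pos[OF I] by (auto simp: L_def U_def)
    \<comment> \<open>\<alpha> n will multiply the mass of h^q0 v on a top half and \<beta> the
      integral of v^(-s) there. Only \<alpha> n depends on the generation, through the bound C2
      \<theta>^n on V I / V K.\<close>
    define \<alpha> where "\<alpha> n = C1 * U * (L * (C2 * \<theta> ^ n) powr \<epsilon> / F I)" for n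
    define \<beta> where "\<beta> = C1 * U * ((V I / L) powr s * C3)"
    have \<alpha>\<beta>: "0 \<le> \<alpha> n" "0 \<le> \<beta>" for n
      using Cs LU F_pos[OF I] by (auto simp: \<alpha>_def \<beta>_def)
    have box: "(\<integral>\<^sup>+z\<in>Tbox K. ennreal (h z) \<partial>lborel) \<le> ennreal (\<alpha> n) * (\<integral>\<^sup>+z\<in>Tbox K. k z \<partial>lborel)
        + ennreal \<beta> * (\<integral>\<^sup>+z\<in>Tbox K. ennreal (v z powr (- s)) \<partial>lborel)" if Kn: "K \<in> S n" for K n
    proof -
      have K: "K \<in> \<D>"
        using S(1) Kn by auto
      have sub: "AE z in lborel. z \<in> Tbox K \<longrightarrow> z \<in> Qbox I"
        using S(4)[of n]
      proof eventually_elim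
        case (elim z)
        have "indicator (Tbox K) z \<le> (\<Sum>K\<in>S n. indicator (Tbox K) z :: ennreal)"
          using Kn S(2) by (intro member_le_sum) auto
        then show ?case
          unfolding elim[symmetric] by (auto simp: indicator_def box_layer_def box_tail_def split: if_splits)
      qed
      have le: "(\<integral>\<^sup>+z\<in>Tbox K. k z \<partial>lborel) \<le> ennreal (F I)"
        unfolding F[OF I, symmetric] k_def[symmetric] using sub
        by (intro nn_integral_mono_AE) (auto simp: indicator_def elim: eventually_mono)
      define FK where "FK = enn2real (\<integral>\<^sup>+z\<in>Tbox K. k z \<partial>lborel)"
      have FK: "(\<integral>\<^sup>+z\<in>Tbox K. k z \<partial>lborel) = ennreal FK"
        using le by (simp add: FK_def le_less_trans less_top)
      have "0 < (\<integral>\<^sup>+z\<in>Tbox K. k z \<partial>lborel)"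
        unfolding k_def using hv_pos by (intro nn_integral_Tbox_pos[OF arc[OF K]]) auto
      then have FK_pos: "0 < FK"
        by (simp add: FK)
      have FK_le: "FK \<le> F I"
        using le F_pos[OF I] by (simp add: FK)
      have "V I \<le> (C2 * \<theta> ^ n) * V K"
        using V_descendant[OF I K S(3)[OF Kn] sub] by (simp add: C2_def \<theta>_def)
      then have "(FK / V K) powr (1 / q0) * (arc_len K)\<^sup>2 \<le> (F I / V I) powr (1 / q0) *
          (L * (C2 * \<theta> ^ n) powr \<epsilon> * (FK / F I) + (V I / L) powr (1 / (q - 1)) *
            ((V K / (arc_len K)\<^sup>2) powr (- (1 / (q - 1))) * (arc_len K)\<^sup>2))"
        using FK_pos FK_le V_pos[OF K] V_pos[OF I] LU len_pos[OF K] q0 \<epsilon>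
        by (intro box_ratio_bound) (auto simp: q_def)
      then have "C1 * ((FK / V K) powr (1 / q0) * (arc_len K)\<^sup>2) \<le> C1 * (U *
          (L * (C2 * \<theta> ^ n) powr \<epsilon> * (FK / F I) + (V I / L) powr s *
            ((V K / (arc_len K)\<^sup>2) powr (- s) * (arc_len K)\<^sup>2)))"
        using Cs unfolding U_def s_def by (intro mult_left_mono)
      also have "\<dots> = \<alpha> n * FK + C1 * U * (V I / L) powr s * ((V K / (arc_len K)\<^sup>2) powr (- s) * (arc_len K)\<^sup>2)"
        by (simp add: \<alpha>_def algebra_simps)
      finally have "(\<integral>\<^sup>+z\<in>Tbox K. ennreal (h z) \<partial>lborel) \<le> ennreal (\<alpha> n * FK +
          C1 * U * (V I / L) powr s * ((V K / (arc_len K)\<^sup>2) powr (- s) * (arc_len K)\<^sup>2))"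
        using nn_integral_top_le[OF K _ h q0 FK[unfolded k_def] FK_pos] unfolding C1_def
        by (auto intro: order_trans ennreal_leI)
      also have "\<dots> = ennreal (\<alpha> n) * ennreal FK + ennreal (C1 * U * (V I / L) powr s) *
          ennreal ((V K / (arc_len K)\<^sup>2) powr (- s) * (arc_len K)\<^sup>2)"
        using \<alpha>\<beta> FK_pos Cs LU by (simp add: ennreal_mult)
      also have "\<dots> \<le> ennreal (\<alpha> n) * ennreal FK + ennreal (C1 * U * (V I / L) powr s) *
          (ennreal C3 * (\<integral>\<^sup>+z\<in>Tbox K. ennreal (v z powr (- s)) \<partial>lborel))"
        using V_density_powr_le[OF K s] unfolding C3_def by (intro add_left_mono mult_left_mono) auto
      also have "\<dots> = ennreal (\<alpha> n) * (\<integral>\<^sup>+z\<in>Tbox K. k z \<partial>lborel)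
          + ennreal \<beta> * (\<integral>\<^sup>+z\<in>Tbox K. ennreal (v z powr (- s)) \<partial>lborel)"
        using Cs LU by (simp add: FK \<beta>_def ennreal_mult mult.assoc)
      finally show ?thesis .
    qed
    have layer: "(\<integral>\<^sup>+z\<in>box_layer I n. ennreal (h z) \<partial>lborel) \<le> ennreal (C1 * U * L * C2 powr \<epsilon> * \<eta> ^ n)
        + ennreal \<beta> * (\<integral>\<^sup>+z\<in>box_layer I n. ennreal (v z powr (- s)) \<partial>lborel)" for n
    proof -
      have "(\<integral>\<^sup>+z\<in>box_layer I n. ennreal (h z) \<partial>lborel) = (\<Sum>K\<in>S n. \<integral>\<^sup>+z\<in>Tbox K. ennreal (h z) \<partial>lborel)"
        by (rule nn_integral_box_layer[OF S(2,4)]) measurable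
      also have "\<dots> \<le> (\<Sum>K\<in>S n. ennreal (\<alpha> n) * (\<integral>\<^sup>+z\<in>Tbox K. k z \<partial>lborel)
        + ennreal \<beta> * (\<integral>\<^sup>+z\<in>Tbox K. ennreal (v z powr (- s)) \<partial>lborel))"
        by (intro sum_mono box)
      also have "\<dots> = ennreal (\<alpha> n) * (\<Sum>K\<in>S n. \<integral>\<^sup>+z\<in>Tbox K. k z \<partial>lborel)
        + ennreal \<beta> * (\<Sum>K\<in>S n. \<integral>\<^sup>+z\<in>Tbox K. ennreal (v z powr (- s)) \<partial>lborel)"
        by (simp add: sum.distrib sum_distrib_left)
      also have "(\<Sum>K\<in>S n. \<integral>\<^sup>+z\<in>Tbox K. k z \<partial>lborel) = (\<integral>\<^sup>+z\<in>box_layer I n. k z \<partial>lborel)"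
        by (rule nn_integral_box_layer[OF S(2,4), symmetric]) measurable
      also have "(\<Sum>K\<in>S n. \<integral>\<^sup>+z\<in>Tbox K. ennreal (v z powr (- s)) \<partial>lborel)
          = (\<integral>\<^sup>+z\<in>box_layer I n. ennreal (v z powr (- s)) \<partial>lborel)"
        by (rule nn_integral_box_layer[OF S(2,4), symmetric]) measurable
      \<comment> \<open>The growth \<theta>^(n \<epsilon>) inside \<alpha> n meets the decay
        \<rho>^n of the mass and leaves \<eta>^n; F I cancels.\<close>
      also have "ennreal (\<alpha> n) * (\<integral>\<^sup>+z\<in>box_layer I n. k z \<partial>lborel) \<le> ennreal (C1 * U * L * C2 powr \<epsilon> * \<eta> ^ n)"
      proof -
        have "(\<integral>\<^sup>+z\<in>box_layer I n. k z \<partial>lborel) \<le> ennreal (\<rho> ^ n) * (\<integral>\<^sup>+z\<in>Qbox I. k z \<partial>lborel)"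
          unfolding \<rho>_def using F[OF I] A'
          by (intro nn_integral_box_layer_decay[OF grid I k _ top']) (auto simp: k_def[symmetric])
        also have "\<dots> = ennreal (\<rho> ^ n * F I)"
          using F[OF I] \<rho> F_pos[OF I] by (simp add: k_def[symmetric] ennreal_mult)
        finally have "ennreal (\<alpha> n) * (\<integral>\<^sup>+z\<in>box_layer I n. k z \<partial>lborel) \<le> ennreal (\<alpha> n * (\<rho> ^ n * F I))"
          using \<alpha>\<beta> \<rho> F_pos[OF I] by (subst ennreal_mult) (auto intro: mult_left_mono)
        also have "\<alpha> n * (\<rho> ^ n * F I) = C1 * U * L * C2 powr \<epsilon> * \<eta> ^ n"
        proof -
          have "(C2 * \<theta> ^ n) powr \<epsilon> = C2 powr \<epsilon> * (\<theta> powr \<epsilon>) ^ n"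
            using Cs \<theta> by (simp add: powr_mult powr_power powr_powr mult.commute flip: powr_realpow)
          then show ?thesis
            using F_pos[OF I] by (simp add: \<alpha>_def \<eta>_def power_mult_distrib field_simps)
        qed
        finally show ?thesis .
      qed
      finally show ?thesis
        by (simp add: add_right_mono)
    qed
    have "(\<integral>\<^sup>+z\<in>Qbox I. ennreal (h z) \<partial>lborel) = (\<Sum>n. \<integral>\<^sup>+z\<in>box_layer I n. ennreal (h z) \<partial>lborel)"
      by (rule nn_integral_Qbox_layers[OF arc[OF I]]) measurable
    also have "\<dots> \<le> (\<Sum>n. ennreal (C1 * U * L * C2 powr \<epsilon> * \<eta> ^ n)
        + ennreal \<beta> * (\<integral>\<^sup>+z\<in>box_layer I n. ennreal (v z powr (- s)) \<partial>lborel))"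
      by (intro suminf_le layer) auto
    also have "\<dots> = (\<Sum>n. ennreal (C1 * U * L * C2 powr \<epsilon> * \<eta> ^ n))
        + ennreal \<beta> * (\<Sum>n. \<integral>\<^sup>+z\<in>box_layer I n. ennreal (v z powr (- s)) \<partial>lborel)"
      by (subst suminf_add[symmetric]) (auto simp: ennreal_suminf_cmult)
    \<comment> \<open>The dual terms carry no decay factor; their sum is reassembled into the
      integral over all of Q_I, to which B_q is applied once.\<close>
    also have "(\<Sum>n. \<integral>\<^sup>+z\<in>box_layer I n. ennreal (v z powr (- s)) \<partial>lborel) = (\<integral>\<^sup>+z\<in>Qbox I. ennreal (v z powr (- s)) \<partial>lborel)"
      by (rule nn_integral_Qbox_layers[OF arc[OF I], symmetric]) measurable
    also have "(\<Sum>n. ennreal (C1 * U * L * C2 powr \<epsilon> * \<eta> ^ n)) = ennreal (C1 * U * L * C2 powr \<epsilon> * (1 / (1 - \<eta>)))"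
      using \<eta> Cs LU by (intro suminf_ennreal_eq sums_mult geometric_sums) auto
    also have "ennreal \<beta> * (\<integral>\<^sup>+z\<in>Qbox I. ennreal (v z powr (- s)) \<partial>lborel)
        \<le> ennreal \<beta> * ennreal (B * L * (V I / L) powr (- s))"
      using B(2)[OF I] unfolding L_def by (intro mult_left_mono) auto
    also have "\<dots> = ennreal (C1 * U * C3 * B * L)"
    proof -
      have "(V I / L) powr s * (V I / L) powr (- s) = 1"
        using V_pos[OF I] LU by (simp flip: powr_add)
      then have "\<beta> * (B * L * (V I / L) powr (- s)) = C1 * U * C3 * B * L"
        unfolding \<beta>_def by (metis (no_types, opaque_lifting) mult.assoc mult.commute mult.right_neutral)
      then show ?thesis
        by (metis ennreal_mult' \<alpha>\<beta>(2))
    qed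
    also have "ennreal (C1 * U * L * C2 powr \<epsilon> * (1 / (1 - \<eta>))) + ennreal (C1 * U * C3 * B * L)
        = ennreal (B' * L * U)"
      using Cs LU B \<eta> by (subst ennreal_plus[symmetric]) (auto simp: B'_def algebra_simps)
    finally show ?thesis
      by (simp add: L_def U_def add_left_mono)
  qed
  moreover have "0 \<le> B'"
    using Cs B \<eta> by (simp add: B'_def)
  ultimately show ?thesis
    by blast
qed

end

section \<open>Reformulation with nonnegative integrals\<close>

text \<open>A weight is positive only almost everywhere and controlled only inside the disc;
  \<open>f'\<close> is a Borel representative that is positive everywhere, so that powers and
  \<open>ennreal\<close> integrals behave. Measurability of \<open>f\<close> on the disc is a
  separate clause because \<open>lborel\<close> is not complete: agreeing almost everywhere with a
  Borel function does not make \<open>f\<close> Borel.\<close>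

definition positive_version :: "(complex \<Rightarrow> real) \<Rightarrow> (complex \<Rightarrow> real) \<Rightarrow> bool" where
  "positive_version f f' \<longleftrightarrow> (\<lambda>z. indicator (ball 0 1) z * f z) \<in> borel_measurable borel \<and>
     f' \<in> borel_measurable borel \<and> (\<forall>z. 0 < f' z) \<and>
     (AE z in lborel. z \<in> ball 0 1 \<longrightarrow> f z = f' z)"

lemma positive_versionD:
  assumes "positive_version f f'"
  shows "(\<lambda>z. indicator (ball 0 1) z * f z) \<in> borel_measurable borel"
    "f' \<in> borel_measurable borel" "0 < f' z" "AE z in lborel. z \<in> ball 0 1 \<longrightarrow> f z = f' z"
  using assms by (auto simp: positive_version_def)

lemma positive_version_1: "positive_version (\<lambda>_. 1) (\<lambda>_. 1)"
  by (simp add: positive_version_def borel_measurable_indicator)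

lemma positive_version_mult:
  assumes f: "positive_version f f'" and g: "positive_version g g'"
  shows "positive_version (\<lambda>z. f z * g z) (\<lambda>z. f' z * g' z)"
proof -
  note [measurable] = positive_versionD(1,2)[OF f] positive_versionD(1,2)[OF g]
  have "(\<lambda>z. indicator (ball 0 1) z * (f z * g z)) = (\<lambda>z. (indicator (ball 0 1) z * f z) * (indicator (ball 0 1) z * g z))"
    by (auto simp: indicator_def)
  moreover have "\<dots> \<in> borel_measurable borel"
    by measurable
  moreover have "AE z in lborel. z \<in> ball 0 1 \<longrightarrow> f z * g z = f' z * g' z"
    using positive_versionD(4)[OF f] positive_versionD(4)[OF g] by eventually_elim auto
  ultimately show ?thesis
    using positive_versionD(3)[OF f] positive_versionD(3)[OF g] by (simp add: positive_version_def)
qed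

lemma positive_version_comp:
  assumes f: "positive_version f f'" and [measurable]: "\<phi> \<in> borel_measurable borel"
    and \<phi>: "\<And>x. 0 < x \<Longrightarrow> \<phi> x = \<phi>' x" "\<And>x. 0 < x \<Longrightarrow> 0 < \<phi>' x" "\<phi>' \<in> borel_measurable borel"
  shows "positive_version (\<lambda>z. \<phi> (f z)) (\<lambda>z. \<phi>' (f' z))"
proof -
  note [measurable] = positive_versionD(1,2)[OF f] \<phi>(3)
  have "(\<lambda>z. indicator (ball 0 1) z * \<phi> (f z)) = (\<lambda>z. indicator (ball 0 1) z * \<phi> (indicator (ball 0 1) z * f z))"
    by (auto simp: indicator_def)
  moreover have "\<dots> \<in> borel_measurable borel"
    by (intro borel_measurable_times borel_measurable_indicator
        measurable_compose[OF positive_versionD(1)[OF f]]) auto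
  moreover have "AE z in lborel. z \<in> ball 0 1 \<longrightarrow> \<phi> (f z) = \<phi>' (f' z)"
    using positive_versionD(4)[OF f] by eventually_elim (use \<phi> positive_versionD(3)[OF f] in auto)
  ultimately show ?thesis
    using positive_versionD(3)[OF f] \<phi> by (simp add: positive_version_def)
qed

lemma positive_version_abs_powr:
  "positive_version f f' \<Longrightarrow> positive_version (\<lambda>z. \<bar>f z\<bar> powr p) (\<lambda>z. f' z powr p)"
  using positive_version_comp[where \<phi> = "\<lambda>x. \<bar>x\<bar> powr p" and \<phi>' = "\<lambda>x. x powr p"] by simp

lemma positive_version_inverse:
  "positive_version f f' \<Longrightarrow> positive_version (\<lambda>z. inverse (f z)) (\<lambda>z. inverse (f' z))"
  using positive_version_comp[where \<phi> = inverse and \<phi>' = inverse] by simp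

lemma positive_version_inverse_powr:
  assumes "positive_version f f'"
  shows "positive_version (\<lambda>z. inverse (f z) powr p) (\<lambda>z. f' z powr (- p))"
  using positive_version_comp[OF assms, where \<phi> = "\<lambda>x. inverse x powr p" and \<phi>' = "\<lambda>x. x powr (- p)"]
  by (simp add: powr_minus powr_divide inverse_eq_divide)

text \<open>The bridge between the Bochner integrals in the definitions of the classes and the
  \<open>ennreal\<close> integrals of the representatives. Strict positivity comes from the positive
  area of T_I.\<close>

lemma positive_version_Qbox:
  assumes f: "positive_version f f'" and I: "is_arc I"
  shows "set_integrable lborel (Qbox I) f \<longleftrightarrow> (\<integral>\<^sup>+z\<in>Qbox I. ennreal (f' z) \<partial>lborel) < \<infinity>"
    and "set_integrable lborel (Qbox I) f \<Longrightarrow>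
      (\<integral>\<^sup>+z\<in>Qbox I. ennreal (f' z) \<partial>lborel) = ennreal (LINT z:Qbox I|lborel. f z)"
    and "set_integrable lborel (Qbox I) f \<Longrightarrow> 0 < (LINT z:Qbox I|lborel. f z)"
proof -
  note [measurable] = positive_versionD(1,2)[OF f]
  have eq: "(\<lambda>z. indicator (Qbox I) z *\<^sub>R f z) = (\<lambda>z. indicator (Qbox I) z * (indicator (ball 0 1) z * f z))"
    using Qbox_subset_ball[of I] by (intro ext) (auto simp: indicator_def)
  have f_meas: "(\<lambda>z. indicator (Qbox I) z *\<^sub>R f z) \<in> borel_measurable lborel"
    unfolding eq by measurable
  have AE_eq: "AE z in lborel. indicator (Qbox I) z *\<^sub>R f z = indicator (Qbox I) z * f' z"
    using positive_versionD(4)[OF f]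
    by eventually_elim (use Qbox_subset_ball[of I] in \<open>auto simp: indicator_def\<close>)
  have nn: "(\<integral>\<^sup>+z\<in>Qbox I. ennreal (f' z) \<partial>lborel) = (\<integral>\<^sup>+z. ennreal (indicator (Qbox I) z * f' z) \<partial>lborel)"
    by (intro nn_integral_cong) (auto simp: indicator_def)
  have nonneg: "0 \<le> indicator (Qbox I) z * f' z" for z
    using positive_versionD(3)[OF f, of z] by simp
  have "set_integrable lborel (Qbox I) f \<longleftrightarrow> integrable lborel (\<lambda>z. indicator (Qbox I) z * f' z)"
    unfolding set_integrable_def using f_meas AE_eq by (intro integrable_cong_AE) auto
  also have "\<dots> \<longleftrightarrow> (\<integral>\<^sup>+z\<in>Qbox I. ennreal (f' z) \<partial>lborel) < \<infinity>"
    using nonneg by (simp add: integrable_iff_bounded nn)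
  finally show int: "set_integrable lborel (Qbox I) f \<longleftrightarrow> (\<integral>\<^sup>+z\<in>Qbox I. ennreal (f' z) \<partial>lborel) < \<infinity>" .
  assume "set_integrable lborel (Qbox I) f"
  then have "integrable lborel (\<lambda>z. indicator (Qbox I) z * f' z)"
    using \<open>set_integrable lborel (Qbox I) f \<longleftrightarrow> integrable lborel (\<lambda>z. indicator (Qbox I) z * f' z)\<close> by simp
  moreover have "(LINT z:Qbox I|lborel. f z) = (LINT z|lborel. indicator (Qbox I) z * f' z)"
    unfolding set_lebesgue_integral_def using f_meas AE_eq by (intro integral_cong_AE) auto
  ultimately show 1: "(\<integral>\<^sup>+z\<in>Qbox I. ennreal (f' z) \<partial>lborel) = ennreal (LINT z:Qbox I|lborel. f z)"
    using nonneg by (simp add: nn nn_integral_eq_integral)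
  have "0 < (\<integral>\<^sup>+z\<in>Tbox I. ennreal (f' z) \<partial>lborel)"
    using positive_versionD(3)[OF f] by (intro nn_integral_Tbox_pos[OF I]) auto
  also have "\<dots> \<le> (\<integral>\<^sup>+z\<in>Qbox I. ennreal (f' z) \<partial>lborel)"
    using Tbox_subset_Qbox[of I] by (intro nn_integral_mono) (auto simp: indicator_def)
  finally show "0 < (LINT z:Qbox I|lborel. f z)"
    by (simp add: 1)
qed

lemma set_lebesgue_integral_Qbox_cong:
  assumes f: "positive_version f h" and g: "positive_version g h"
  shows "(LINT z:Qbox I|lborel. f z) = (LINT z:Qbox I|lborel. g z)"
proof -
  note [measurable] = positive_versionD(1)[OF f] positive_versionD(1)[OF g]
  have eq: "(\<lambda>z. indicator (Qbox I) z *\<^sub>R k z) = (\<lambda>z. indicator (Qbox I) z * (indicator (ball 0 1) z * k z))" for k :: "complex \<Rightarrow> real"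
    using Qbox_subset_ball[of I] by (intro ext) (auto simp: indicator_def)
  have "AE z in lborel. indicator (Qbox I) z * (indicator (ball 0 1) z * f z)
      = indicator (Qbox I) z * (indicator (ball 0 1) z * g z)"
    using positive_versionD(4)[OF f] positive_versionD(4)[OF g]
    by eventually_elim (auto simp: indicator_def)
  then show ?thesis
    unfolding set_lebesgue_integral_def eq by (intro integral_cong_AE) auto
qed

text \<open>X, Y, Z are the masses of w, u w and u^(-1/(p-1)) w. The mean of 1/u with exponent
  1/(p-1) carries the outer power p - 1. For p > 1 the definitions take the integral branch, not the
  essential supremum.\<close>

lemma Bclass_nn_integral:
  assumes B: "Bclass p w \<J> u" and p: "1 < p" and \<J>: "\<And>I. I \<in> \<J> \<Longrightarrow> is_arc I"
    and u: "positive_version u u'" and w: "positive_version w w'"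
  obtains C X Y Z where "0 \<le> C"
    "\<And>I. I \<in> \<J> \<Longrightarrow> 0 < X I" "\<And>I. I \<in> \<J> \<Longrightarrow> 0 < Y I" "\<And>I. I \<in> \<J> \<Longrightarrow> 0 < Z I"
    "\<And>I. I \<in> \<J> \<Longrightarrow> (\<integral>\<^sup>+z\<in>Qbox I. ennreal (w' z) \<partial>lborel) = ennreal (X I)"
    "\<And>I. I \<in> \<J> \<Longrightarrow> (\<integral>\<^sup>+z\<in>Qbox I. ennreal (u' z * w' z) \<partial>lborel) = ennreal (Y I)"
    "\<And>I. I \<in> \<J> \<Longrightarrow> (\<integral>\<^sup>+z\<in>Qbox I. ennreal (u' z powr (- (1 / (p - 1))) * w' z) \<partial>lborel) = ennreal (Z I)"
    "\<And>I. I \<in> \<J> \<Longrightarrow> Y I / X I * (Z I / X I) powr (p - 1) \<le> C"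
proof -
  define s where "s = 1 / (p - 1)"
  have s: "1 / s = p - 1"
    using p by (auto simp: s_def)
  obtain C where C: "\<And>I. I \<in> \<J> \<Longrightarrow> set_integrable lborel (Qbox I) w"
    "\<And>I. I \<in> \<J> \<Longrightarrow> set_integrable lborel (Qbox I) (\<lambda>z. u z * w z)"
    "\<And>I. I \<in> \<J> \<Longrightarrow> set_integrable lborel (Qbox I) (\<lambda>z. inverse (u z) powr s * w z)"
    "\<And>I. I \<in> \<J> \<Longrightarrow> wavg 1 w (Qbox I) u * wavg s w (Qbox I) (\<lambda>z. inverse (u z)) \<le> C"
    using B p unfolding Bclass_def inv_finite_def inv_avg_def s_def by auto
  define X where "X I = (LINT z:Qbox I|lborel. w z)" for I
  define Y where "Y I = (LINT z:Qbox I|lborel. u z * w z)" for I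
  define Z where "Z I = (LINT z:Qbox I|lborel. inverse (u z) powr s * w z)" for I
  note uw = positive_version_mult[OF u w]
  note iuw = positive_version_mult[OF positive_version_inverse_powr[OF u, of s] w]
  have "(LINT z:Qbox I|lborel. \<bar>u z\<bar> powr 1 * w z) = Y I" for I
    unfolding Y_def using positive_version_mult[OF positive_version_abs_powr[OF u, of 1] w] uw
    by (intro set_lebesgue_integral_Qbox_cong) (auto simp: positive_versionD(3)[OF u] less_imp_le)
  moreover have "(LINT z:Qbox I|lborel. \<bar>inverse (u z)\<bar> powr s * w z) = Z I" for I
  proof -
    have "inverse (u' z) powr s = u' z powr (- s)" for z
      using positive_versionD(3)[OF u, of z] by (simp add: powr_minus powr_divide inverse_eq_divide)
    then show ?thesis
      unfolding Z_def
      using positive_version_mult[OF positive_version_abs_powr[OF positive_version_inverse[OF u], of s] w] iuw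
      by (intro set_lebesgue_integral_Qbox_cong) auto
  qed
  ultimately have avg: "Y I / X I * (Z I / X I) powr (p - 1) \<le> C" if "I \<in> \<J>" "0 < X I" "0 < Y I" for I
    using C(4)[OF that(1)] that by (simp add: wavg_def X_def[symmetric] s)
  show thesis
  proof (rule that[of "max C 0" X Y Z])
    fix I assume I: "I \<in> \<J>"
    show XY: "0 < X I" "0 < Y I" "0 < Z I"
      unfolding X_def Y_def Z_def
      using positive_version_Qbox(3)[OF w \<J>[OF I]] positive_version_Qbox(3)[OF uw \<J>[OF I]]
        positive_version_Qbox(3)[OF iuw \<J>[OF I]] C(1-3)[OF I] by auto
    show "(\<integral>\<^sup>+z\<in>Qbox I. ennreal (w' z) \<partial>lborel) = ennreal (X I)"
      "(\<integral>\<^sup>+z\<in>Qbox I. ennreal (u' z * w' z) \<partial>lborel) = ennreal (Y I)"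
      "(\<integral>\<^sup>+z\<in>Qbox I. ennreal (u' z powr (- (1 / (p - 1))) * w' z) \<partial>lborel) = ennreal (Z I)"
      unfolding X_def Y_def Z_def s_def[symmetric]
      using positive_version_Qbox(2)[OF w \<J>[OF I]] positive_version_Qbox(2)[OF uw \<J>[OF I]]
        positive_version_Qbox(2)[OF iuw \<J>[OF I]] C(1-3)[OF I] by auto
    show "Y I / X I * (Z I / X I) powr (p - 1) \<le> max C 0"
      using avg[OF I XY(1,2)] by simp
  qed simp
qed

text \<open>X and Y are universally quantified so that the masses obtained from a B_p condition can
  be inserted. Raising to the power p removes the root in the p-mean.\<close>

lemma RHclass_nn_integral:
  assumes R: "RHclass p w \<J> u" and p: "0 < p" and \<J>: "\<And>I. I \<in> \<J> \<Longrightarrow> is_arc I"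
    and u: "positive_version u u'" and w: "positive_version w w'"
  obtains C R where "0 \<le> C" "\<And>I. I \<in> \<J> \<Longrightarrow> 0 < R I"
    "\<And>I. I \<in> \<J> \<Longrightarrow> (\<integral>\<^sup>+z\<in>Qbox I. ennreal (u' z powr p * w' z) \<partial>lborel) = ennreal (R I)"
    "\<And>I X Y. I \<in> \<J> \<Longrightarrow> 0 < X \<Longrightarrow> 0 < Y \<Longrightarrow> (\<integral>\<^sup>+z\<in>Qbox I. ennreal (w' z) \<partial>lborel) = ennreal X \<Longrightarrow>
      (\<integral>\<^sup>+z\<in>Qbox I. ennreal (u' z * w' z) \<partial>lborel) = ennreal Y \<Longrightarrow> R I / X \<le> (C * (Y / X)) powr p"
proof -
  obtain C where C: "\<And>I. I \<in> \<J> \<Longrightarrow> set_integrable lborel (Qbox I) w"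
    "\<And>I. I \<in> \<J> \<Longrightarrow> set_integrable lborel (Qbox I) (\<lambda>z. u z * w z)"
    "\<And>I. I \<in> \<J> \<Longrightarrow> set_integrable lborel (Qbox I) (\<lambda>z. \<bar>u z\<bar> powr p * w z)"
    "\<And>I. I \<in> \<J> \<Longrightarrow> wavg p w (Qbox I) u \<le> C * wavg 1 w (Qbox I) u"
    using R unfolding RHclass_def by auto
  define R where "R I = (LINT z:Qbox I|lborel. \<bar>u z\<bar> powr p * w z)" for I
  note uw = positive_version_mult[OF u w]
  note upw = positive_version_mult[OF positive_version_abs_powr[OF u, of p] w]
  have u1: "(LINT z:Qbox I|lborel. \<bar>u z\<bar> powr 1 * w z) = (LINT z:Qbox I|lborel. u z * w z)" for I
    using positive_version_mult[OF positive_version_abs_powr[OF u, of 1] w] uw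
    by (intro set_lebesgue_integral_Qbox_cong) (auto simp: positive_versionD(3)[OF u] less_imp_le)
  show thesis
  proof (rule that[of "max C 0" R])
    fix I assume I: "I \<in> \<J>"
    show R_pos: "0 < R I"
      unfolding R_def using positive_version_Qbox(3)[OF upw \<J>[OF I]] C(3)[OF I] .
    show "(\<integral>\<^sup>+z\<in>Qbox I. ennreal (u' z powr p * w' z) \<partial>lborel) = ennreal (R I)"
      unfolding R_def using positive_version_Qbox(2)[OF upw \<J>[OF I]] C(3)[OF I] .
    fix X Y :: real
    assume XY: "0 < X" "0 < Y" and X: "(\<integral>\<^sup>+z\<in>Qbox I. ennreal (w' z) \<partial>lborel) = ennreal X"
      and Y: "(\<integral>\<^sup>+z\<in>Qbox I. ennreal (u' z * w' z) \<partial>lborel) = ennreal Y"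
    have X': "(LINT z:Qbox I|lborel. w z) = X"
      using X XY positive_version_Qbox(2,3)[OF w \<J>[OF I] C(1)[OF I]] by simp
    have Y': "(LINT z:Qbox I|lborel. \<bar>u z\<bar> powr 1 * w z) = Y"
      using Y XY positive_version_Qbox(2,3)[OF uw \<J>[OF I] C(2)[OF I]] by (simp only: u1) simp
    have "(R I / X) powr (1 / p) \<le> C * (Y / X)"
      using C(4)[OF I] XY unfolding wavg_def X' Y' R_def[symmetric] by simp
    also have "\<dots> \<le> max C 0 * (Y / X)"
      using XY by (intro mult_right_mono) auto
    finally have "((R I / X) powr (1 / p)) powr p \<le> (max C 0 * (Y / X)) powr p"
      using p by (intro powr_mono2) auto
    then show "R I / X \<le> (max C 0 * (Y / X)) powr p"
      using p R_pos XY by (simp add: powr_powr)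
  qed simp
qed

text \<open>Local integrability gives measurability on compact subsets of the disc; the closed discs
  of radius 1 - 1/(n+1) exhaust it, and the truncations of u converge pointwise. \<open>u'\<close>
  takes the value 1 off the disc and wherever u is not positive.\<close>

lemma weight_positive_version:
  assumes "weight u"
  obtains u' where "positive_version u u'"
proof -
  have "(\<lambda>z. indicator (cball 0 (1 - 1 / real (Suc n))) z *\<^sub>R u z) \<in> borel_measurable borel" for n
  proof -
    have "0 < 1 / real (Suc n)"
      by simp
    then have "cball 0 (1 - 1 / real (Suc n)) \<subseteq> ball (0::complex) 1"
      by (simp only: cball_subset_ball_iff) simp
    then have "set_integrable lborel (cball 0 (1 - 1 / real (Suc n))) u"
      using assms by (simp add: weight_def)
    from borel_measurable_integrable[OF this[unfolded set_integrable_def]] show ?thesis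
      by simp
  qed
  moreover have "(\<lambda>n. indicator (cball 0 (1 - 1 / real (Suc n))) z *\<^sub>R u z) \<longlonglongrightarrow> indicator (ball 0 1) z * u z" for z
  proof (cases "norm z < 1")
    case True
    have "(\<lambda>n. 1 - 1 / real (Suc n)) \<longlonglongrightarrow> 1 - 0"
      by (intro tendsto_intros LIMSEQ_Suc lim_1_over_n)
    then have "\<forall>\<^sub>F n in sequentially. norm z < 1 - 1 / real (Suc n)"
      using True by (intro order_tendstoD) auto
    then have "\<forall>\<^sub>F n in sequentially. indicator (cball 0 (1 - 1 / real (Suc n))) z *\<^sub>R u z = indicator (ball 0 1) z * u z"
      by eventually_elim (use True in \<open>auto simp: indicator_def\<close>)
    then show ?thesis
      by (rule tendsto_eventually)
  next
    case False
    have "z \<notin> cball 0 (1 - 1 / real (Suc n))" for n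
    proof -
      have "0 < 1 / real (Suc n)"
        by simp
      with False show ?thesis
        unfolding mem_cball_0 by linarith
    qed
    then show ?thesis
      using False by (auto simp: indicator_def)
  qed
  ultimately have u [measurable]: "(\<lambda>z. indicator (ball 0 1) z * u z) \<in> borel_measurable borel"
    by (rule borel_measurable_LIMSEQ_real[rotated])
  define u' where "u' z = (if 0 < indicator (ball 0 1) z * u z then indicator (ball 0 1) z * u z else 1)" for z
  have "u' \<in> borel_measurable borel"
    unfolding u'_def by measurable
  moreover have "AE z in lborel. z \<in> ball 0 1 \<longrightarrow> u z = u' z"
    using assms unfolding weight_def by (auto simp: u'_def elim!: eventually_mono)
  ultimately have "positive_version u u'"
    using u by (auto simp: positive_version_def u'_def)
  then show thesis ..
qed

section \<open>The conformal weight\<close>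

text \<open>The disc of radius (1 - |w|)/2 about w lies in the dilated box up to a null set and has
  area pi/4 (1 - |w|)^2; in it v^p equals |g|^(2p).\<close>

lemma submean_Qbox_dilate:
  fixes v :: "complex \<Rightarrow> real"
  assumes g: "g holomorphic_on ball 0 1" "\<And>z. z \<in> ball 0 1 \<Longrightarrow> g z \<noteq> 0"
    and v: "\<And>z. z \<in> ball 0 1 \<Longrightarrow> v z = (cmod (g z))\<^sup>2"
    and I: "is_arc I" "w \<in> Qbox I"
  shows "ennreal (v w powr p * (pi / 4 * (1 - norm w)\<^sup>2)) \<le> (\<integral>\<^sup>+z\<in>Qbox (arc_dilate I). ennreal (v z powr p) \<partial>lborel)"
proof -
  define r where "r = (1 - norm w) / 2"
  have r: "0 < r"
    using I(2) by (simp add: r_def Qbox_iff)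
  have sub: "ball w r \<subseteq> ball 0 1"
  proof -
    have "norm w = 1 - 2 * r"
      unfolding r_def by (simp add: diff_divide_distrib)
    with r show ?thesis
      by (intro ball_subset_ball_iff[THEN iffD2]) auto
  qed
  have vp: "cmod (g z) powr (2 * p) = v z powr p" if "z \<in> ball 0 1" for z
  proof -
    have "v z = cmod (g z) powr 2"
      using v[OF that] g(2)[OF that] by (simp add: powr_numeral)
    then show ?thesis
      by (simp only: powr_powr)
  qed
  have "ennreal (cmod (g w) powr (2 * p)) * emeasure lborel (ball w r)
      \<le> (\<integral>\<^sup>+z\<in>ball w r. ennreal (cmod (g z) powr (2 * p)) \<partial>lborel)"
    using g sub r by (intro powr_norm_area_submean) (auto intro: holomorphic_on_subset)
  also have "\<dots> \<le> (\<integral>\<^sup>+z\<in>Qbox (arc_dilate I). ennreal (v z powr p) \<partial>lborel)"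
  proof (rule nn_integral_mono_AE, use AE_ball_subset_Qbox_dilate[OF I, folded r_def] in eventually_elim)
    case (elim z)
    then show ?case
      using vp[of z] sub by (auto simp: indicator_def)
  qed
  also have "cmod (g w) powr (2 * p) = v w powr p"
    using I(2) by (intro vp) (auto simp: Qbox_iff)
  also have "ennreal (v w powr p) * emeasure lborel (ball w r) = ennreal (v w powr p * (pi / 4 * (1 - norm w)\<^sup>2))"
    using r by (simp add: emeasure_ball_complex r_def power_divide flip: ennreal_mult)
  finally show ?thesis .
qed

text \<open>The concrete V I for \<open>grid_weight\<close>; it is also formed for the dual weight
  v^(-1/(q-1)). The B_q condition makes both integrals finite, so \<open>enn2real\<close> loses
  nothing there.\<close>

definition dilate_integral :: "(complex \<Rightarrow> real) \<Rightarrow> complex set \<Rightarrow> real" where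
  "dilate_integral v I = enn2real (\<integral>\<^sup>+z\<in>Qbox (arc_dilate I). ennreal (v z) \<partial>lborel)"

text \<open>The B_q condition for the dilated arc, cleared of denominators: with X the area of its
  box it reads Y Z^(q-1) <= C X^q. The area bound 36 pi (3l)^2 is the source of 324 pi.\<close>

lemma Bclass_dilate:
  assumes B: "Bclass q (\<lambda>_. 1) all_arcs w" and q: "1 < q" and w: "positive_version w v"
  obtains C where "0 \<le> C"
    "\<And>I. is_arc I \<Longrightarrow> 0 < dilate_integral v I"
    "\<And>I. is_arc I \<Longrightarrow> (\<integral>\<^sup>+z\<in>Qbox (arc_dilate I). ennreal (v z) \<partial>lborel) = ennreal (dilate_integral v I)"
    "\<And>I. is_arc I \<Longrightarrow> (\<integral>\<^sup>+z\<in>Qbox (arc_dilate I). ennreal (v z powr (- (1 / (q - 1)))) \<partial>lborel)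
       = ennreal (dilate_integral (\<lambda>z. v z powr (- (1 / (q - 1)))) I)"
    "\<And>I. is_arc I \<Longrightarrow> dilate_integral v I * dilate_integral (\<lambda>z. v z powr (- (1 / (q - 1)))) I powr (q - 1)
       \<le> C * ((arc_len I)\<^sup>2) powr q"
proof -
  have arcs: "is_arc I" if "I \<in> all_arcs" for I
    using that by (simp add: all_arcs_def)
  obtain C X Y Z where C: "0 \<le> C"
    and XYZ: "\<And>I. I \<in> all_arcs \<Longrightarrow> 0 < X I" "\<And>I. I \<in> all_arcs \<Longrightarrow> 0 < Y I" "\<And>I. I \<in> all_arcs \<Longrightarrow> 0 < Z I"
    "\<And>I. I \<in> all_arcs \<Longrightarrow> (\<integral>\<^sup>+z\<in>Qbox I. ennreal 1 \<partial>lborel) = ennreal (X I)"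
    "\<And>I. I \<in> all_arcs \<Longrightarrow> (\<integral>\<^sup>+z\<in>Qbox I. ennreal (v z * 1) \<partial>lborel) = ennreal (Y I)"
    "\<And>I. I \<in> all_arcs \<Longrightarrow> (\<integral>\<^sup>+z\<in>Qbox I. ennreal (v z powr (- (1 / (q - 1))) * 1) \<partial>lborel) = ennreal (Z I)"
    "\<And>I. I \<in> all_arcs \<Longrightarrow> Y I / X I * (Z I / X I) powr (q - 1) \<le> C"
    by (rule Bclass_nn_integral[OF B q arcs w positive_version_1]) (assumption, rule that, assumption+)
  have J: "arc_dilate I \<in> all_arcs" if "is_arc I" for I
    using arc_dilate(1)[OF that] by (simp add: all_arcs_def)
  have Y: "dilate_integral v I = Y (arc_dilate I)"
    and Z: "dilate_integral (\<lambda>z. v z powr (- (1 / (q - 1)))) I = Z (arc_dilate I)" if "is_arc I" for I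
    using XYZ(5,6)[OF J[OF that]] XYZ(2,3)[OF J[OF that]] by (auto simp: dilate_integral_def)
  show thesis
  proof (rule that[of "C * (324 * pi) powr q"])
    show "0 \<le> C * (324 * pi) powr q"
      using C by simp
    fix I assume I: "is_arc I"
    note XYZ = XYZ[OF J[OF I]]
    show "0 < dilate_integral v I"
      "(\<integral>\<^sup>+z\<in>Qbox (arc_dilate I). ennreal (v z) \<partial>lborel) = ennreal (dilate_integral v I)"
      "(\<integral>\<^sup>+z\<in>Qbox (arc_dilate I). ennreal (v z powr (- (1 / (q - 1)))) \<partial>lborel)
         = ennreal (dilate_integral (\<lambda>z. v z powr (- (1 / (q - 1)))) I)"
      using XYZ by (simp_all add: Y[OF I] Z[OF I])
    let ?X = "X (arc_dilate I)" and ?Y = "Y (arc_dilate I)" and ?Z = "Z (arc_dilate I)"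
    have "ennreal ?X = emeasure lborel (Qbox (arc_dilate I))"
      by (simp flip: XYZ(4))
    also have "\<dots> \<le> ennreal (36 * pi * (arc_len (arc_dilate I))\<^sup>2)"
      by (rule emeasure_Qbox_le[OF arc_dilate(1)[OF I]])
    also have "\<dots> \<le> ennreal (36 * pi * (3 * arc_len I)\<^sup>2)"
      using arc_len_bounds[OF I] unfolding arc_dilate(2)[OF I]
      by (intro ennreal_leI mult_left_mono power_mono) auto
    finally have X: "?X \<le> 324 * pi * (arc_len I)\<^sup>2"
      by (simp add: power_mult_distrib)
    have "?Y * ?Z powr (q - 1) = (?Y / ?X * (?Z / ?X) powr (q - 1)) * ?X powr q"
    proof -
      have "?X powr q = ?X * ?X powr (q - 1)"
        using XYZ(1) by (simp add: powr_diff)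
      then show ?thesis
        using XYZ(1) by (simp add: powr_divide)
    qed
    also have "\<dots> \<le> C * (324 * pi * (arc_len I)\<^sup>2) powr q"
      using C XYZ(1,7) X q by (intro mult_mono powr_mono2) auto
    also have "\<dots> = C * (324 * pi) powr q * ((arc_len I)\<^sup>2) powr q"
      by (simp only: powr_mult mult.assoc)
    finally show "dilate_integral v I * dilate_integral (\<lambda>z. v z powr (- (1 / (q - 1)))) I powr (q - 1)
       \<le> C * (324 * pi) powr q * ((arc_len I)\<^sup>2) powr q"
      by (simp add: Y[OF I] Z[OF I])
  qed
qed

text \<open>The upper bound on v is its own sub-mean value property. The lower bound is that of
  v^(-s) with s = 1/(q-1): it bounds v(z)^(-s) (1 - |z|)^2 by the dual mass, which B_q bounds in
  terms of V. Raising to the power q - 1 produces the exponent 2 (q - 1).\<close>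

lemma dilate_integral_bounds:
  fixes v :: "complex \<Rightarrow> real"
  assumes g: "g holomorphic_on ball 0 1" "\<And>z. z \<in> ball 0 1 \<Longrightarrow> g z \<noteq> 0"
    and v: "\<And>z. z \<in> ball 0 1 \<Longrightarrow> v z = (cmod (g z))\<^sup>2"
    and B: "Bclass q (\<lambda>_. 1) all_arcs w" and q: "1 < q" and w: "positive_version w v"
  obtains C where "1 \<le> C"
    "\<And>I z. is_arc I \<Longrightarrow> z \<in> Tbox I \<Longrightarrow> (arc_len I)\<^sup>2 * v z \<le> C * dilate_integral v I"
    "\<And>I z. is_arc I \<Longrightarrow> z \<in> Qbox I \<Longrightarrow>
      dilate_integral v I \<le> C * (arc_len I)\<^sup>2 * (arc_len I / (1 - norm z)) powr (2 * (q - 1)) * v z"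
proof -
  define s where "s = 1 / (q - 1)"
  have s: "s * (q - 1) = 1" "0 < s"
    using q by (auto simp: s_def)
  obtain C where C: "0 \<le> C"
    and V: "\<And>I. is_arc I \<Longrightarrow> 0 < dilate_integral v I"
    "\<And>I. is_arc I \<Longrightarrow> (\<integral>\<^sup>+z\<in>Qbox (arc_dilate I). ennreal (v z) \<partial>lborel) = ennreal (dilate_integral v I)"
    and W: "\<And>I. is_arc I \<Longrightarrow> (\<integral>\<^sup>+z\<in>Qbox (arc_dilate I). ennreal (v z powr (- s)) \<partial>lborel)
       = ennreal (dilate_integral (\<lambda>z. v z powr (- s)) I)"
    and VW: "\<And>I. is_arc I \<Longrightarrow> dilate_integral v I * dilate_integral (\<lambda>z. v z powr (- s)) I powr (q - 1)
       \<le> C * ((arc_len I)\<^sup>2) powr q"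
    by (rule Bclass_dilate[OF B q w, folded s_def]) (rule that, assumption+)
  have W0: "0 \<le> dilate_integral (\<lambda>z. v z powr (- s)) I" for I
    by (simp add: dilate_integral_def)
  have vpos: "0 < v z" for z
    using positive_versionD(3)[OF w] .
  \<comment> \<open>16 is the reciprocal of (1/4) (1/2)^2, from the area pi/4 (1 - |z|)^2 with 1 -
    |z| >= l/2 and pi >= 1; the other entry is the constant of the lower bound.\<close>
  define C' where "C' = max 16 (C * (4 / pi) powr (q - 1))"
  show thesis
  proof (rule that[of C'])
    show "1 \<le> C'"
      by (simp add: C'_def)
    fix I z assume I: "is_arc I"
    let ?l = "arc_len I" and ?V = "dilate_integral v I" and ?W = "dilate_integral (\<lambda>z. v z powr (- s)) I"
    have l: "0 < ?l"
      using arc_len_bounds[OF I] by simp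
    {
      assume z: "z \<in> Tbox I"
      then have zQ: "z \<in> Qbox I" "?l / 2 \<le> 1 - norm z"
        by (auto simp: Tbox_iff)
      have "ennreal (v z * (pi / 4 * (1 - norm z)\<^sup>2)) \<le> ennreal ?V"
        using submean_Qbox_dilate[OF g v I zQ(1), of 1] V(2)[OF I] vpos less_imp_le[OF vpos] by simp
      then have "v z * (pi / 4 * (1 - norm z)\<^sup>2) \<le> ?V"
        using V(1)[OF I] by (simp add: ennreal_le_iff)
      moreover have "v z * (1 / 4 * (?l / 2)\<^sup>2) \<le> v z * (pi / 4 * (1 - norm z)\<^sup>2)"
        using zQ(2) l less_imp_le[OF vpos] pi_ge_two by (intro mult_left_mono mult_mono power_mono) auto
      ultimately have "?l\<^sup>2 * v z \<le> 16 * ?V"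
        by (simp add: power_divide mult.commute)
      also have "\<dots> \<le> C' * ?V"
        using V(1)[OF I] by (intro mult_right_mono) (auto simp: C'_def)
      finally show "?l\<^sup>2 * v z \<le> C' * ?V" .
    }
    assume z: "z \<in> Qbox I"
    then have z1: "0 < 1 - norm z"
      by (simp add: Qbox_iff)
    define a where "a = pi / 4 * (1 - norm z)\<^sup>2"
    have a: "0 < a"
      using z1 by (simp add: a_def)
    have "v z powr (- s) * a \<le> ?W"
      using submean_Qbox_dilate[OF g v I z, of "- s"] W[OF I] W0[of I] by (simp add: a_def ennreal_le_iff)
    then have "(v z powr (- s) * a) powr (q - 1) \<le> ?W powr (q - 1)"
      using a q by (intro powr_mono2) auto
    also have "(v z powr (- s) * a) powr (q - 1) = a powr (q - 1) / v z"
    proof -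
      have "(v z powr (- s)) powr (q - 1) = v z powr (- 1)"
        using s(1) unfolding powr_powr by simp
      also have "\<dots> = 1 / v z"
        using vpos[of z] by (simp add: powr_minus_divide)
      finally show ?thesis
        unfolding powr_mult by simp
    qed
    finally have "?V * (a powr (q - 1) / v z) \<le> C * (?l\<^sup>2) powr q"
      using VW[OF I] V(1)[OF I] by (meson mult_left_mono less_imp_le order_trans)
    then have "?V \<le> C * ((?l\<^sup>2) powr q / a powr (q - 1)) * v z"
      using a vpos[of z] by (simp add: field_simps)
    also have "(?l\<^sup>2) powr q / a powr (q - 1) = (4 / pi) powr (q - 1) * ?l\<^sup>2 * (?l / (1 - norm z)) powr (2 * (q - 1))"
    proof -
      have "(?l\<^sup>2) powr q = ?l\<^sup>2 * (?l\<^sup>2) powr (q - 1)"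
        using l by (simp add: powr_diff)
      then have "(?l\<^sup>2) powr q / a powr (q - 1) = ?l\<^sup>2 * ((?l\<^sup>2) powr (q - 1) / a powr (q - 1))"
        by simp
      also have "(?l\<^sup>2) powr (q - 1) / a powr (q - 1) = ((4 / pi) * (?l / (1 - norm z)) powr 2) powr (q - 1)"
        using l z1 a by (simp add: a_def power_divide mult.commute flip: powr_divide)
      also have "\<dots> = (4 / pi) powr (q - 1) * (?l / (1 - norm z)) powr (2 * (q - 1))"
        by (simp only: powr_mult powr_powr)
      finally show ?thesis
        by (simp only: mult_ac)
    qed
    also have "C * ((4 / pi) powr (q - 1) * ?l\<^sup>2 * (?l / (1 - norm z)) powr (2 * (q - 1))) * v z
        = (C * (4 / pi) powr (q - 1)) * (?l\<^sup>2 * (?l / (1 - norm z)) powr (2 * (q - 1)) * v z)"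
      by (simp add: mult_ac)
    also have "\<dots> \<le> C' * (?l\<^sup>2 * (?l / (1 - norm z)) powr (2 * (q - 1)) * v z)"
      using less_imp_le[OF vpos] by (intro mult_right_mono) (auto simp: C'_def)
    finally show "?V \<le> C' * ?l\<^sup>2 * (?l / (1 - norm z)) powr (2 * (q - 1)) * v z"
      by (simp add: mult_ac)
  qed
qed

text \<open>The B_q inequality on the dilated arc is solved for the dual mass. With s = 1/(q-1) one
  has q s = 1 + s, which splits the power of the squared length into an area factor and a density
  factor.\<close>

lemma nn_integral_dual_Qbox_le:
  assumes B: "Bclass q (\<lambda>_. 1) all_arcs w" and q: "1 < q" and w: "positive_version w v"
  shows "\<exists>C\<ge>0. \<forall>I. is_arc I \<longrightarrow> (\<integral>\<^sup>+z\<in>Qbox I. ennreal (v z powr (- (1 / (q - 1)))) \<partial>lborel)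
    \<le> ennreal (C * (arc_len I)\<^sup>2 * (dilate_integral v I / (arc_len I)\<^sup>2) powr (- (1 / (q - 1))))"
proof -
  define s where "s = 1 / (q - 1)"
  have s: "(q - 1) * s = 1" "0 < s"
    using q by (auto simp: s_def)
  obtain C where C: "0 \<le> C"
    and V: "\<And>I. is_arc I \<Longrightarrow> 0 < dilate_integral v I"
    "\<And>I. is_arc I \<Longrightarrow> (\<integral>\<^sup>+z\<in>Qbox (arc_dilate I). ennreal (v z) \<partial>lborel) = ennreal (dilate_integral v I)"
    and W: "\<And>I. is_arc I \<Longrightarrow> (\<integral>\<^sup>+z\<in>Qbox (arc_dilate I). ennreal (v z powr (- s)) \<partial>lborel)
       = ennreal (dilate_integral (\<lambda>z. v z powr (- s)) I)"
    and VW: "\<And>I. is_arc I \<Longrightarrow> dilate_integral v I * dilate_integral (\<lambda>z. v z powr (- s)) I powr (q - 1)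
       \<le> C * ((arc_len I)\<^sup>2) powr q"
    by (rule Bclass_dilate[OF B q w, folded s_def]) (rule that, assumption+)
  have "(\<integral>\<^sup>+z\<in>Qbox I. ennreal (v z powr (- s)) \<partial>lborel)
      \<le> ennreal (C powr s * (arc_len I)\<^sup>2 * (dilate_integral v I / (arc_len I)\<^sup>2) powr (- s))" if I: "is_arc I" for I
  proof -
    let ?l = "arc_len I" and ?V = "dilate_integral v I" and ?W = "dilate_integral (\<lambda>z. v z powr (- s)) I"
    have l: "0 < ?l"
      using arc_len_bounds[OF I] by simp
    have W0: "0 \<le> ?W"
      by (simp add: dilate_integral_def)
    have "?W powr (q - 1) \<le> C * (?l\<^sup>2) powr q / ?V"
      using VW[OF I] V(1)[OF I] by (simp add: field_simps)
    then have "(?W powr (q - 1)) powr s \<le> (C * (?l\<^sup>2) powr q / ?V) powr s"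
      using s by (intro powr_mono2) auto
    also have "(?W powr (q - 1)) powr s = ?W"
      using s W0 by (simp add: powr_powr)
    also have "(C * (?l\<^sup>2) powr q / ?V) powr s = C powr s * ?l\<^sup>2 * (?V / ?l\<^sup>2) powr (- s)"
    proof -
      have "q * s = 1 + s"
        using s by (simp add: algebra_simps)
      then have "((?l\<^sup>2) powr q) powr s = ?l\<^sup>2 * (?l\<^sup>2) powr s"
        using l by (simp add: powr_powr powr_add)
      then show ?thesis
        using V(1)[OF I] l by (simp add: powr_mult powr_divide powr_minus field_simps)
    qed
    finally have "?W \<le> C powr s * ?l\<^sup>2 * (?V / ?l\<^sup>2) powr (- s)" .
    moreover have "(\<integral>\<^sup>+z\<in>Qbox I. ennreal (v z powr (- s)) \<partial>lborel) \<le> ennreal ?W"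
      unfolding W[OF I, symmetric] using AE_Qbox_subset_dilate[OF I]
      by (intro nn_integral_mono_AE) (auto simp: indicator_def elim: eventually_mono)
    ultimately show ?thesis
      by (meson ennreal_leI order_trans)
  qed
  then show ?thesis
    unfolding s_def by (intro exI[of _ "C powr (1 / (q - 1))"]) auto
qed

section \<open>Removing the weight\<close>

context grid_weight begin

lemma nn_integral_v_Tbox_ge:
  assumes "I \<in> \<D>"
  shows "ennreal (pi / (64 * (C * 2 powr b)) * V I) \<le> (\<integral>\<^sup>+z\<in>Tbox I. ennreal (v z) \<partial>lborel)"
proof -
  define c where "c = V I / (C * 2 powr b * (arc_len I)\<^sup>2)"
  have c: "0 \<le> c"
    using V_pos[OF assms] C_ge_1 by (simp add: c_def)
  have "c \<le> v z" if "z \<in> Tbox I" for z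
    using V_le_v_top[OF assms that] C_ge_1 len_pos[OF assms] by (simp add: c_def field_simps)
  then have "(\<integral>\<^sup>+z\<in>Tbox I. ennreal c \<partial>lborel) \<le> (\<integral>\<^sup>+z\<in>Tbox I. ennreal (v z) \<partial>lborel)"
    by (intro nn_integral_mono) (auto simp: indicator_def intro: ennreal_leI)
  also have "(\<integral>\<^sup>+z\<in>Tbox I. ennreal c \<partial>lborel) = ennreal c * emeasure lborel (Tbox I)"
    by (subst nn_integral_cmult_indicator) auto
  finally have "ennreal c * ennreal (pi / 64 * (arc_len I)\<^sup>2) \<le> (\<integral>\<^sup>+z\<in>Tbox I. ennreal (v z) \<partial>lborel)"
    using emeasure_Tbox_ge[OF arc[OF assms]] by (meson mult_left_mono order_trans zero_le)
  also have "ennreal c * ennreal (pi / 64 * (arc_len I)\<^sup>2) = ennreal (c * (pi / 64 * (arc_len I)\<^sup>2))"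
    using c by (simp flip: ennreal_mult)
  also have "c * (pi / 64 * (arc_len I)\<^sup>2) = pi / (64 * (C * 2 powr b)) * V I"
    using len_pos[OF assms] C_ge_1 by (simp add: c_def field_simps)
  finally show ?thesis .
qed

text \<open>By Cauchy--Schwarz, the \<open>v\<close>-mass of the top half is controlled by the product of the masses of
  \<open>f\<close> and \<open>1/f\<close> there; hence each of them carries a fixed fraction of its total mass in the top half.\<close>

lemma nn_integral_top_fraction:
  fixes f :: "complex \<Rightarrow> real"
  assumes I: "I \<in> \<D>" and [measurable]: "f \<in> borel_measurable borel" and f: "\<And>z. 0 < f z"
    and F: "(\<integral>\<^sup>+z\<in>Qbox I. ennreal (f z * v z) \<partial>lborel) = ennreal F"
    and G: "(\<integral>\<^sup>+z\<in>Qbox I. ennreal (inverse (f z) * v z) \<partial>lborel) = ennreal G"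
    and FG: "0 < F" "0 < G" "F * G \<le> M * (V I)\<^sup>2"
  shows "(\<integral>\<^sup>+z\<in>Qbox I. ennreal (f z * v z) \<partial>lborel)
    \<le> ennreal (M / (pi / (64 * (C * 2 powr b)))\<^sup>2) * (\<integral>\<^sup>+z\<in>Tbox I. ennreal (f z * v z) \<partial>lborel)"
proof -
  define \<kappa> where "\<kappa> = pi / (64 * (C * 2 powr b))"
  have \<kappa>: "0 < \<kappa>"
    using C_ge_1 by (simp add: \<kappa>_def)
  have sub: "(\<integral>\<^sup>+z\<in>Tbox I. k z \<partial>lborel) \<le> (\<integral>\<^sup>+z\<in>Qbox I. k z \<partial>lborel)" for k :: "complex \<Rightarrow> ennreal"
    using Tbox_subset_Qbox[of I] by (intro nn_integral_mono) (auto simp: indicator_def)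
  define FT where "FT = enn2real (\<integral>\<^sup>+z\<in>Tbox I. ennreal (f z * v z) \<partial>lborel)"
  have FT: "(\<integral>\<^sup>+z\<in>Tbox I. ennreal (f z * v z) \<partial>lborel) = ennreal FT" "0 \<le> FT"
    using sub[of "\<lambda>z. ennreal (f z * v z)"] F by (auto simp: FT_def le_less_trans less_top)
  have "(ennreal (\<kappa> * V I))\<^sup>2 \<le> (\<integral>\<^sup>+z\<in>Tbox I. ennreal (v z) \<partial>lborel)\<^sup>2"
    using nn_integral_v_Tbox_ge[OF I] unfolding \<kappa>_def by (intro power_mono) auto
  also have "(\<integral>\<^sup>+z\<in>Tbox I. ennreal (v z) \<partial>lborel)
      = (\<integral>\<^sup>+z. (ennreal (sqrt (f z * v z)) * indicator (Tbox I) z) * (ennreal (sqrt (inverse (f z) * v z)) * indicator (Tbox I) z) \<partial>lborel)"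
  proof (rule nn_integral_cong)
    fix z
    have "f z * v z * (inverse (f z) * v z) = (v z)\<^sup>2"
      using f[of z] by (simp add: field_simps power2_eq_square)
    then have "sqrt (f z * v z) * sqrt (inverse (f z) * v z) = v z"
      using v_pos[of z] by (simp flip: real_sqrt_mult)
    then show "ennreal (v z) * indicator (Tbox I) z
        = (ennreal (sqrt (f z * v z)) * indicator (Tbox I) z) * (ennreal (sqrt (inverse (f z) * v z)) * indicator (Tbox I) z)"
      using f[of z] v_pos[of z] by (auto simp: indicator_def simp flip: ennreal_mult)
  qed
  also have "\<dots>\<^sup>2 \<le> (\<integral>\<^sup>+z. (ennreal (sqrt (f z * v z)) * indicator (Tbox I) z)\<^sup>2 \<partial>lborel) *
      (\<integral>\<^sup>+z. (ennreal (sqrt (inverse (f z) * v z)) * indicator (Tbox I) z)\<^sup>2 \<partial>lborel)"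
    by (rule Cauchy_Schwarz_nn_integral) measurable
  also have "\<dots> = (\<integral>\<^sup>+z\<in>Tbox I. ennreal (f z * v z) \<partial>lborel) * (\<integral>\<^sup>+z\<in>Tbox I. ennreal (inverse (f z) * v z) \<partial>lborel)"
    using less_imp_le[OF f] less_imp_le[OF v_pos]
    by (intro arg_cong2[where f = "(*)"] nn_integral_cong) (auto simp: indicator_def ennreal_power)
  \<comment> \<open>Only the factor with 1/f is enlarged to the full box, so that G can be cancelled
    at the end while FT stays on the top half.\<close>
  also have "\<dots> \<le> ennreal FT * ennreal G"
    using sub[of "\<lambda>z. ennreal (inverse (f z) * v z)"] G FT by (auto intro: mult_left_mono)
  also have "\<dots> = ennreal (FT * G)"
    using FT FG by (simp add: ennreal_mult)
  finally have "(\<kappa> * V I)\<^sup>2 \<le> FT * G"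
    using \<kappa> V_pos[OF I] FT FG by (simp add: ennreal_power ennreal_le_iff)
  then have *: "(V I)\<^sup>2 \<le> FT * G / \<kappa>\<^sup>2"
    using \<kappa> by (simp add: power_mult_distrib field_simps)
  \<comment> \<open>The sign of M is forced by the positivity of F * G.\<close>
  have "0 < M * (V I)\<^sup>2"
    using FG by (smt (verit) mult_pos_pos)
  then have M: "0 \<le> M"
    by (simp add: zero_less_mult_iff)
  have "F * G \<le> M * (FT * G / \<kappa>\<^sup>2)"
    using FG(3) mult_left_mono[OF * M] by linarith
  then have "F * G \<le> (M / \<kappa>\<^sup>2 * FT) * G"
    by (simp add: mult_ac)
  then have "F \<le> M / \<kappa>\<^sup>2 * FT"
    using FG(2) by (rule mult_right_le_imp_le)
  then show ?thesis
    unfolding F FT \<kappa>_def[symmetric] using M FT by (simp flip: ennreal_mult)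
qed

text \<open>The hypotheses are symmetric under exchanging u with 1/u and F with G, so the higher
  integrability estimate applies to both. The averages are at most multiples of (F I / V I)^(1/q0)
  and (G I / V I)^(1/q0), and the product of these is at most M^(1/q0).\<close>

lemma nn_integral_product_le:
  fixes u :: "complex \<Rightarrow> real"
  assumes [measurable]: "u \<in> borel_measurable borel" and u: "\<And>z. 0 < u z" and q0: "1 \<le> q0"
    and F: "\<And>I. I \<in> \<D> \<Longrightarrow> (\<integral>\<^sup>+z\<in>Qbox I. ennreal (u z powr q0 * v z) \<partial>lborel) = ennreal (F I)"
    and G: "\<And>I. I \<in> \<D> \<Longrightarrow> (\<integral>\<^sup>+z\<in>Qbox I. ennreal (u z powr (- q0) * v z) \<partial>lborel) = ennreal (G I)"
    and FG: "\<And>I. I \<in> \<D> \<Longrightarrow> 0 < F I" "\<And>I. I \<in> \<D> \<Longrightarrow> 0 < G I" "\<And>I. I \<in> \<D> \<Longrightarrow> F I * G I \<le> M * (V I)\<^sup>2"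
    and Bq: "\<And>q. q0 < q \<Longrightarrow> \<exists>B\<ge>0. \<forall>I\<in>\<D>. (\<integral>\<^sup>+z\<in>Qbox I. ennreal (v z powr (- (1 / (q - 1)))) \<partial>lborel)
        \<le> ennreal (B * (arc_len I)\<^sup>2 * (V I / (arc_len I)\<^sup>2) powr (- (1 / (q - 1))))"
  shows "\<exists>B\<ge>0. \<forall>I\<in>\<D>. \<exists>Y\<ge>0. \<exists>Z\<ge>0. (\<integral>\<^sup>+z\<in>Qbox I. ennreal (u z) \<partial>lborel) \<le> ennreal Y \<and>
    (\<integral>\<^sup>+z\<in>Qbox I. ennreal (inverse (u z)) \<partial>lborel) \<le> ennreal Z \<and> Y * Z \<le> B * ((arc_len I)\<^sup>2)\<^sup>2"
proof -
  have inv: "inverse (u z) powr q0 = u z powr (- q0)" "inverse (u z powr q0) = u z powr (- q0)"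
    "inverse (u z powr (- q0)) = u z powr q0" for z
    using u[of z] by (auto simp: powr_minus powr_divide inverse_eq_divide)
  have up: "0 < u z powr p" for p z
    using u[of z] by simp
  define A where "A = M / (pi / (64 * (C * 2 powr b)))\<^sup>2"
  have topF: "(\<integral>\<^sup>+z\<in>Qbox I. ennreal (u z powr q0 * v z) \<partial>lborel) \<le> ennreal A * (\<integral>\<^sup>+z\<in>Tbox I. ennreal (u z powr q0 * v z) \<partial>lborel)"
    if "I \<in> \<D>" for I
    unfolding A_def using F[OF that] G[OF that] FG[OF that] up
    by (intro nn_integral_top_fraction[OF that, where F = "F I" and G = "G I"]) (auto simp: inv)
  have topG: "(\<integral>\<^sup>+z\<in>Qbox I. ennreal (inverse (u z) powr q0 * v z) \<partial>lborel)
      \<le> ennreal A * (\<integral>\<^sup>+z\<in>Tbox I. ennreal (inverse (u z) powr q0 * v z) \<partial>lborel)"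
    if "I \<in> \<D>" for I
    unfolding A_def inv using F[OF that] G[OF that] FG[OF that] up
    by (intro nn_integral_top_fraction[OF that, where F = "G I" and G = "F I"]) (auto simp: inv mult.commute)
  obtain B1 where B1: "0 \<le> B1" "\<And>I. I \<in> \<D> \<Longrightarrow> (\<integral>\<^sup>+z\<in>Qbox I. ennreal (u z) \<partial>lborel)
      \<le> ennreal (B1 * (arc_len I)\<^sup>2 * (F I / V I) powr (1 / q0))"
    using nn_integral_Qbox_le[OF _ u q0 F FG(1) topF Bq] by auto
  obtain B2 where B2: "0 \<le> B2" "\<And>I. I \<in> \<D> \<Longrightarrow> (\<integral>\<^sup>+z\<in>Qbox I. ennreal (inverse (u z)) \<partial>lborel)
      \<le> ennreal (B2 * (arc_len I)\<^sup>2 * (G I / V I) powr (1 / q0))"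
    using nn_integral_Qbox_le[OF _ _ q0 G[folded inv(1)] FG(2) topG Bq] u by auto
  have "\<exists>Y\<ge>0. \<exists>Z\<ge>0. (\<integral>\<^sup>+z\<in>Qbox I. ennreal (u z) \<partial>lborel) \<le> ennreal Y \<and>
    (\<integral>\<^sup>+z\<in>Qbox I. ennreal (inverse (u z)) \<partial>lborel) \<le> ennreal Z \<and>
    Y * Z \<le> B1 * B2 * M powr (1 / q0) * ((arc_len I)\<^sup>2)\<^sup>2" if I: "I \<in> \<D>" for I
  proof (intro exI conjI)
    let ?L = "(arc_len I)\<^sup>2"
    have "F I / V I * (G I / V I) \<le> M"
      using FG(3)[OF I] V_pos[OF I] by (simp add: field_simps power2_eq_square)
    then have "(F I / V I * (G I / V I)) powr (1 / q0) \<le> M powr (1 / q0)"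
      using FG(1,2)[OF I] V_pos[OF I] q0 by (intro powr_mono2) auto
    then have "(B1 * B2 * ?L\<^sup>2) * ((F I / V I) powr (1 / q0) * (G I / V I) powr (1 / q0)) \<le> (B1 * B2 * ?L\<^sup>2) * M powr (1 / q0)"
      using B1 B2 unfolding powr_mult by (intro mult_left_mono) auto
    then show "(B1 * ?L * (F I / V I) powr (1 / q0)) * (B2 * ?L * (G I / V I) powr (1 / q0))
        \<le> B1 * B2 * M powr (1 / q0) * ?L\<^sup>2"
      by (simp add: power2_eq_square mult_ac)
  qed (use B1(1) B2(1) B1(2)[OF I] B2(2)[OF I] in auto)
  moreover have "0 \<le> B1 * B2 * M powr (1 / q0)"
    using B1 B2 by simp
  ultimately show ?thesis
    by blast
qed

end

section \<open>Passage between the classes and bounds on masses, and the theorem\<close>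

text \<open>For p = 2 the dual exponent 1/(p-1) is 1. Dividing by the squared area of Q_I calls for
  a lower area bound, which the top half supplies; hence the constant pi / 64.\<close>

lemma Bclass_2I:
  assumes u: "positive_version u u'" and \<J>: "\<And>I. I \<in> \<J> \<Longrightarrow> is_arc I" and "0 \<le> B"
    and le: "\<And>I. I \<in> \<J> \<Longrightarrow> \<exists>Y\<ge>0. \<exists>Z\<ge>0. (\<integral>\<^sup>+z\<in>Qbox I. ennreal (u' z) \<partial>lborel) \<le> ennreal Y \<and>
    (\<integral>\<^sup>+z\<in>Qbox I. ennreal (inverse (u' z)) \<partial>lborel) \<le> ennreal Z \<and> Y * Z \<le> B * ((arc_len I)\<^sup>2)\<^sup>2"
  shows "Bclass 2 (\<lambda>_. 1) \<J> u"
  unfolding Bclass_def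
proof (intro exI ballI)
  fix I assume I: "I \<in> \<J>"
  note arc = \<J>[OF I]
  have l: "0 < arc_len I"
    using arc_len_bounds[OF arc] by simp
  obtain Y Z where YZ: "0 \<le> Y" "0 \<le> Z" "(\<integral>\<^sup>+z\<in>Qbox I. ennreal (u' z) \<partial>lborel) \<le> ennreal Y"
    "(\<integral>\<^sup>+z\<in>Qbox I. ennreal (inverse (u' z)) \<partial>lborel) \<le> ennreal Z" "Y * Z \<le> B * ((arc_len I)\<^sup>2)\<^sup>2"
    using le[OF I] by blast
  have u1: "positive_version (\<lambda>z. \<bar>u z\<bar> powr 1) u'"
    using positive_version_abs_powr[OF u, of 1] positive_versionD(3)[OF u] by (simp add: less_imp_le)
  note iu = positive_version_inverse[OF u]
  have iu1: "positive_version (\<lambda>z. \<bar>inverse (u z)\<bar> powr 1) (\<lambda>z. inverse (u' z))"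
    using positive_version_abs_powr[OF iu, of 1] positive_versionD(3)[OF iu] by (simp add: less_imp_le)
  have iu2: "positive_version (\<lambda>z. inverse (u z) powr 1) (\<lambda>z. inverse (u' z))"
    using positive_version_inverse_powr[OF u, of 1] positive_versionD(3)[OF u]
    by (simp add: powr_minus less_imp_le)
  have fin: "(\<integral>\<^sup>+z\<in>Qbox I. ennreal (u' z) \<partial>lborel) < \<infinity>" "(\<integral>\<^sup>+z\<in>Qbox I. ennreal (inverse (u' z)) \<partial>lborel) < \<infinity>"
    using YZ by (auto intro: le_less_trans)
  have int1: "set_integrable lborel (Qbox I) (\<lambda>_. 1 :: real)"
    using positive_version_Qbox(1)[OF positive_version_1 arc] emeasure_Qbox_le[OF arc]
    by (simp add: le_less_trans)
  define X where "X = (LINT z:Qbox I|lborel. 1 :: real)"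
  have "ennreal (pi / 64 * (arc_len I)\<^sup>2) \<le> emeasure lborel (Qbox I)"
    using emeasure_Tbox_ge[OF arc] emeasure_mono[OF Tbox_subset_Qbox[of I], of lborel] by (auto intro: order_trans)
  also have "\<dots> = ennreal X"
    using positive_version_Qbox(2)[OF positive_version_1 arc int1] by (simp add: X_def)
  finally have X: "pi / 64 * (arc_len I)\<^sup>2 \<le> X"
    using positive_version_Qbox(3)[OF positive_version_1 arc int1] by (simp add: X_def ennreal_le_iff)
  have X_pos: "0 < X"
    using positive_version_Qbox(3)[OF positive_version_1 arc int1] by (simp add: X_def)
  have iY: "set_integrable lborel (Qbox I) (\<lambda>z. \<bar>u z\<bar> powr 1)"
    and iZ: "set_integrable lborel (Qbox I) (\<lambda>z. \<bar>inverse (u z)\<bar> powr 1)"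
    and iu_int: "set_integrable lborel (Qbox I) u" "set_integrable lborel (Qbox I) (\<lambda>z. inverse (u z) powr 1)"
    using fin positive_version_Qbox(1)[OF u1 arc] positive_version_Qbox(1)[OF iu1 arc]
      positive_version_Qbox(1)[OF u arc] positive_version_Qbox(1)[OF iu2 arc] by auto
  define Y' where "Y' = (LINT z:Qbox I|lborel. \<bar>u z\<bar> powr 1)"
  define Z' where "Z' = (LINT z:Qbox I|lborel. \<bar>inverse (u z)\<bar> powr 1)"
  have Y': "0 < Y'" "Y' \<le> Y"
    using positive_version_Qbox(2,3)[OF u1 arc iY] YZ(1,3) by (auto simp: Y'_def ennreal_le_iff)
  have Z': "0 < Z'" "Z' \<le> Z"
    using positive_version_Qbox(2,3)[OF iu1 arc iZ] YZ(2,4) by (auto simp: Z'_def ennreal_le_iff)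
  have "Y' / X * (Z' / X) = (Y' * Z') / X\<^sup>2"
    by (simp add: power2_eq_square)
  also have "\<dots> \<le> (B * ((arc_len I)\<^sup>2)\<^sup>2) / (pi / 64 * (arc_len I)\<^sup>2)\<^sup>2"
  proof (intro frac_le)
    show "Y' * Z' \<le> B * ((arc_len I)\<^sup>2)\<^sup>2"
      using mult_mono[OF Y'(2) Z'(2) YZ(1)] Z' YZ(5) by simp
    show "(pi / 64 * (arc_len I)\<^sup>2)\<^sup>2 \<le> X\<^sup>2"
      using X by (intro power_mono) auto
  qed (use l \<open>0 \<le> B\<close> in auto)
  also have "\<dots> = B / (pi / 64)\<^sup>2"
    using l unfolding power_mult_distrib by simp
  finally have "Y' / X * (Z' / X) \<le> B / (pi / 64)\<^sup>2" .
  moreover have "wavg 1 (\<lambda>_. 1) (Qbox I) u = Y' / X"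
    using Y' X_pos by (simp add: wavg_def Y'_def X_def)
  moreover have "wavg 1 (\<lambda>_. 1) (Qbox I) (\<lambda>z. inverse (u z)) = Z' / X"
    using Z' X_pos by (simp add: wavg_def Z'_def X_def)
  ultimately show "set_integrable lborel (Qbox I) (\<lambda>_. 1 :: real) \<and>
      set_integrable lborel (Qbox I) (\<lambda>z. u z * 1) \<and> inv_finite 2 (\<lambda>_. 1) (Qbox I) u \<and>
      wavg 1 (\<lambda>_. 1) (Qbox I) u * inv_avg 2 (\<lambda>_. 1) (Qbox I) u \<le> B / (pi / 64)\<^sup>2"
    using int1 iu_int by (simp add: inv_finite_def inv_avg_def)
qed

text \<open>For q0 = 1 the B_2 condition is already the claim. For q0 > 1 let p = (q0 + 1)/q0; then
  1/(p-1) = q0, so the B_p condition pairs u with u^(-q0), and the reverse Hoelder condition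
  replaces the mean of u by the q0-mean. Multiplying the two bounds gives the constant (D
  C)^q0.\<close>

lemma dual_weight_bound:
  assumes q0: "1 \<le> q0" and \<J>: "\<And>I. I \<in> \<J> \<Longrightarrow> is_arc I"
    and B: "(q0 = 1 \<and> Bclass 2 w \<J> u) \<or> (1 < q0 \<and> Bclass ((q0 + 1) / q0) w \<J> u \<and> RHclass q0 w \<J> u)"
    and u: "positive_version u u'" and w: "positive_version w w'"
  obtains M X F G where "0 \<le> M"
    "\<And>I. I \<in> \<J> \<Longrightarrow> 0 < X I" "\<And>I. I \<in> \<J> \<Longrightarrow> 0 < F I" "\<And>I. I \<in> \<J> \<Longrightarrow> 0 < G I"
    "\<And>I. I \<in> \<J> \<Longrightarrow> (\<integral>\<^sup>+z\<in>Qbox I. ennreal (w' z) \<partial>lborel) = ennreal (X I)"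
    "\<And>I. I \<in> \<J> \<Longrightarrow> (\<integral>\<^sup>+z\<in>Qbox I. ennreal (u' z powr q0 * w' z) \<partial>lborel) = ennreal (F I)"
    "\<And>I. I \<in> \<J> \<Longrightarrow> (\<integral>\<^sup>+z\<in>Qbox I. ennreal (u' z powr (- q0) * w' z) \<partial>lborel) = ennreal (G I)"
    "\<And>I. I \<in> \<J> \<Longrightarrow> F I * G I \<le> M * (X I)\<^sup>2"
proof (cases "q0 = 1")
  case True
  then have B2: "Bclass 2 w \<J> u"
    using B by simp
  obtain C X Y Z where C: "0 \<le> C"
    and X: "\<And>I. I \<in> \<J> \<Longrightarrow> 0 < X I" and Y: "\<And>I. I \<in> \<J> \<Longrightarrow> 0 < Y I" and Z: "\<And>I. I \<in> \<J> \<Longrightarrow> 0 < Z I"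
    and X': "\<And>I. I \<in> \<J> \<Longrightarrow> (\<integral>\<^sup>+z\<in>Qbox I. ennreal (w' z) \<partial>lborel) = ennreal (X I)"
    and Y': "\<And>I. I \<in> \<J> \<Longrightarrow> (\<integral>\<^sup>+z\<in>Qbox I. ennreal (u' z * w' z) \<partial>lborel) = ennreal (Y I)"
    and Z': "\<And>I. I \<in> \<J> \<Longrightarrow> (\<integral>\<^sup>+z\<in>Qbox I. ennreal (u' z powr (- (1 / (2 - 1))) * w' z) \<partial>lborel) = ennreal (Z I)"
    and le: "\<And>I. I \<in> \<J> \<Longrightarrow> Y I / X I * (Z I / X I) powr (2 - 1) \<le> C"
    by (rule Bclass_nn_integral[OF B2 _ \<J> u w]) (simp, assumption, rule that, assumption+)
  show thesis
  proof (rule that[OF C X Y Z X'])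
    fix I assume I: "I \<in> \<J>"
    show "(\<integral>\<^sup>+z\<in>Qbox I. ennreal (u' z powr q0 * w' z) \<partial>lborel) = ennreal (Y I)"
      using Y'[OF I] positive_versionD(3)[OF u] by (simp add: True less_imp_le)
    show "(\<integral>\<^sup>+z\<in>Qbox I. ennreal (u' z powr (- q0) * w' z) \<partial>lborel) = ennreal (Z I)"
      using Z'[OF I] by (simp add: True)
    show "Y I * Z I \<le> C * (X I)\<^sup>2"
      using le[OF I] X[OF I] Z[OF I] by (simp add: field_simps power2_eq_square)
  qed
next
  case False
  then have q1: "1 < q0" and Bp: "Bclass ((q0 + 1) / q0) w \<J> u" and RH: "RHclass q0 w \<J> u"
    using B by auto
  have p: "1 < (q0 + 1) / q0" "(q0 + 1) / q0 - 1 = 1 / q0"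
    using q1 by (auto simp: field_simps)
  have p': "1 / (1 / q0) = q0"
    by simp
  obtain C X Y Z where C: "0 \<le> C"
    and X: "\<And>I. I \<in> \<J> \<Longrightarrow> 0 < X I" and Y: "\<And>I. I \<in> \<J> \<Longrightarrow> 0 < Y I" and Z: "\<And>I. I \<in> \<J> \<Longrightarrow> 0 < Z I"
    and X': "\<And>I. I \<in> \<J> \<Longrightarrow> (\<integral>\<^sup>+z\<in>Qbox I. ennreal (w' z) \<partial>lborel) = ennreal (X I)"
    and Y': "\<And>I. I \<in> \<J> \<Longrightarrow> (\<integral>\<^sup>+z\<in>Qbox I. ennreal (u' z * w' z) \<partial>lborel) = ennreal (Y I)"
    and Z': "\<And>I. I \<in> \<J> \<Longrightarrow> (\<integral>\<^sup>+z\<in>Qbox I. ennreal (u' z powr (- q0) * w' z) \<partial>lborel) = ennreal (Z I)"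
    and le: "\<And>I. I \<in> \<J> \<Longrightarrow> Y I / X I * (Z I / X I) powr (1 / q0) \<le> C"
    by (rule Bclass_nn_integral[OF Bp p(1) \<J> u w, unfolded p(2) p']) (assumption, rule that, assumption+)
  obtain D R where D: "0 \<le> D" and R: "\<And>I. I \<in> \<J> \<Longrightarrow> 0 < R I"
    and R': "\<And>I. I \<in> \<J> \<Longrightarrow> (\<integral>\<^sup>+z\<in>Qbox I. ennreal (u' z powr q0 * w' z) \<partial>lborel) = ennreal (R I)"
    and R_le: "\<And>I X Y. I \<in> \<J> \<Longrightarrow> 0 < X \<Longrightarrow> 0 < Y \<Longrightarrow> (\<integral>\<^sup>+z\<in>Qbox I. ennreal (w' z) \<partial>lborel) = ennreal X \<Longrightarrow>
      (\<integral>\<^sup>+z\<in>Qbox I. ennreal (u' z * w' z) \<partial>lborel) = ennreal Y \<Longrightarrow> R I / X \<le> (D * (Y / X)) powr q0"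
    by (rule RHclass_nn_integral[OF RH less_trans[OF zero_less_one q1] \<J> u w]) (assumption, rule that, assumption+)
  show thesis
  proof (rule that[OF _ X R Z X' R' Z'])
    show "0 \<le> (D * C) powr q0"
      by simp
    fix I assume I: "I \<in> \<J>"
    have "R I / X I * (Z I / X I) \<le> (D * (Y I / X I)) powr q0 * (Z I / X I)"
      using R_le[OF I X[OF I] Y[OF I] X'[OF I] Y'[OF I]] X[OF I] Z[OF I] by (intro mult_right_mono) auto
    also have "\<dots> = (D * (Y I / X I)) powr q0 * ((Z I / X I) powr (1 / q0)) powr q0"
      using q1 X[OF I] Z[OF I] by (simp add: powr_powr)
    also have "\<dots> = (D * (Y I / X I * (Z I / X I) powr (1 / q0))) powr q0"
      by (simp only: powr_mult mult.assoc)
    also have "\<dots> \<le> (D * C) powr q0"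
      using D q1 le[OF I] X[OF I] Y[OF I] by (intro powr_mono2 mult_left_mono) auto
    finally show "R I * Z I \<le> (D * C) powr q0 * (X I)\<^sup>2"
      using X[OF I] by (simp add: field_simps power2_eq_square)
  qed
qed

theorem theorem3p2:
  fixes \<psi> :: "complex \<Rightarrow> complex" and \<D> :: "complex set set"
    and q0 :: real and u :: "complex \<Rightarrow> real"
  assumes "\<psi> holomorphic_on ball 0 1" and "inj_on \<psi> (ball 0 1)"
    and "dyadic_grid \<D>"
    and "q0 \<ge> 1"
    and "\<forall>q>q0. Bclass q (\<lambda>_. 1) all_arcs (\<lambda>z. (cmod (deriv \<psi> z))\<^sup>2)"
    and "weight u"
    and "(q0 = 1 \<and> Bclass 2 (\<lambda>z. (cmod (deriv \<psi> z))\<^sup>2) \<D> u) \<or>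
         (1 < q0 \<and> Bclass ((q0 + 1) / q0) (\<lambda>z. (cmod (deriv \<psi> z))\<^sup>2) \<D> u \<and>
                   RHclass q0 (\<lambda>z. (cmod (deriv \<psi> z))\<^sup>2) \<D> u)"
  shows "Bclass 2 (\<lambda>_. 1) \<D> u"
proof -
  define g where "g = deriv \<psi>"
  have g: "g holomorphic_on ball 0 1" "\<And>z. z \<in> ball 0 1 \<Longrightarrow> g z \<noteq> 0"
    unfolding g_def using assms(1,2) holomorphic_deriv holomorphic_injective_imp_regular by blast+
  define w where "w z = (cmod (g z))\<^sup>2" for z
  have w_eq: "w = (\<lambda>z. (cmod (deriv \<psi> z))\<^sup>2)"
    by (intro ext) (simp add: w_def g_def)
  \<comment> \<open>The value 1 off the disc makes v positive on the whole plane, as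
    \<open>positive_version\<close> demands.\<close>
  define v where "v z = (if z \<in> ball 0 1 then w z else 1)" for z
  have "continuous_on (ball 0 1) w"
    unfolding w_def using holomorphic_on_imp_continuous_on[OF g(1)] by (intro continuous_intros)
  then have w_meas: "(\<lambda>z. indicator (ball 0 1) z * w z) \<in> borel_measurable borel"
    using borel_measurable_continuous_on_indicator[of "ball 0 1" w] by simp
  have "v = (\<lambda>z. indicator (ball 0 1) z * w z + indicator (- ball 0 1) z)"
    by (intro ext) (auto simp: v_def indicator_def)
  moreover have "(\<lambda>z. indicator (ball 0 1) z * w z + indicator (- ball 0 1) z) \<in> borel_measurable borel"
    using w_meas by (intro borel_measurable_add borel_measurable_indicator) auto
  ultimately have v_meas: "v \<in> borel_measurable borel"
    by simp
  have w: "positive_version w v"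
    using w_meas v_meas g(2) by (auto simp: positive_version_def v_def w_def)
  have vg: "v z = (cmod (g z))\<^sup>2" if "z \<in> ball 0 1" for z
    using that by (simp add: v_def w_def)
  obtain u' where u: "positive_version u u'"
    using weight_positive_version[OF assms(6)] .
  have arc: "is_arc I" if "I \<in> \<D>" for I
    using dyadic_grid_is_arc[OF assms(3) that] .
  have Bq: "Bclass q (\<lambda>_. 1) all_arcs w" "1 < q" if "q0 < q" for q
    using assms(4,5) that by (auto simp: w_eq)
  \<comment> \<open>The pointwise bounds call for one fixed exponent above q0, and q0 + 1 is a
    convenient one. \<open>dilate_integral v\<close> does not involve the exponent, so the same V I
    serves every q > q0 later.\<close>
  obtain C where C: "1 \<le> C"
    "\<And>I z. is_arc I \<Longrightarrow> z \<in> Tbox I \<Longrightarrow> (arc_len I)\<^sup>2 * v z \<le> C * dilate_integral v I"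
    "\<And>I z. is_arc I \<Longrightarrow> z \<in> Qbox I \<Longrightarrow>
      dilate_integral v I \<le> C * (arc_len I)\<^sup>2 * (arc_len I / (1 - norm z)) powr (2 * (q0 + 1 - 1)) * v z"
    by (rule dilate_integral_bounds[OF g vg Bq[of "q0 + 1"] w]) (assumption, assumption, simp, simp, rule that, assumption+)
  obtain C' where V: "\<And>I. is_arc I \<Longrightarrow> 0 < dilate_integral v I"
    "\<And>I. is_arc I \<Longrightarrow> (\<integral>\<^sup>+z\<in>Qbox (arc_dilate I). ennreal (v z) \<partial>lborel) = ennreal (dilate_integral v I)"
    by (rule Bclass_dilate[OF Bq[of "q0 + 1"] w]) (simp, simp, rule that, assumption+)
  interpret grid_weight \<D> v "dilate_integral v" C "2 * (q0 + 1 - 1)"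
    using assms(3,4) C V(1) arc v_meas positive_versionD(3)[OF w] by unfold_locales auto
  obtain M X F G where M: "0 \<le> M"
    and X: "\<And>I. I \<in> \<D> \<Longrightarrow> 0 < X I" and FG: "\<And>I. I \<in> \<D> \<Longrightarrow> 0 < F I" "\<And>I. I \<in> \<D> \<Longrightarrow> 0 < G I"
    and X': "\<And>I. I \<in> \<D> \<Longrightarrow> (\<integral>\<^sup>+z\<in>Qbox I. ennreal (v z) \<partial>lborel) = ennreal (X I)"
    and F: "\<And>I. I \<in> \<D> \<Longrightarrow> (\<integral>\<^sup>+z\<in>Qbox I. ennreal (u' z powr q0 * v z) \<partial>lborel) = ennreal (F I)"
    and G: "\<And>I. I \<in> \<D> \<Longrightarrow> (\<integral>\<^sup>+z\<in>Qbox I. ennreal (u' z powr (- q0) * v z) \<partial>lborel) = ennreal (G I)"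
    and le: "\<And>I. I \<in> \<D> \<Longrightarrow> F I * G I \<le> M * (X I)\<^sup>2"
    by (rule dual_weight_bound[OF assms(4) arc assms(7)[folded w_eq] u w])
      (assumption, rule that, assumption+)
  \<comment> \<open>The bound obtained so far refers to the mass X I of v on Q_I; the mass on the
    dilated box is at least as large, so the bound passes to it.\<close>
  have FG_le: "F I * G I \<le> M * (dilate_integral v I)\<^sup>2" if I: "I \<in> \<D>" for I
  proof -
    have "ennreal (X I) \<le> ennreal (dilate_integral v I)"
      unfolding X'[OF I, symmetric] V(2)[OF arc[OF I], symmetric] using AE_Qbox_subset_dilate[OF arc[OF I]]
      by (intro nn_integral_mono_AE) (auto simp: indicator_def elim: eventually_mono)
    then have "X I \<le> dilate_integral v I"
      using V(1)[OF arc[OF I]] by (simp add: ennreal_le_iff)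
    then have "M * (X I)\<^sup>2 \<le> M * (dilate_integral v I)\<^sup>2"
      using M X[OF I] by (intro mult_left_mono power_mono) auto
    then show ?thesis
      using le[OF I] by linarith
  qed
  have dual: "\<exists>B\<ge>0. \<forall>I\<in>\<D>. (\<integral>\<^sup>+z\<in>Qbox I. ennreal (v z powr (- (1 / (q - 1)))) \<partial>lborel)
        \<le> ennreal (B * (arc_len I)\<^sup>2 * (dilate_integral v I / (arc_len I)\<^sup>2) powr (- (1 / (q - 1))))"
    if "q0 < q" for q
    using nn_integral_dual_Qbox_le[OF Bq[OF that] w] arc by blast
  have "\<exists>B\<ge>0. \<forall>I\<in>\<D>. \<exists>Y\<ge>0. \<exists>Z\<ge>0. (\<integral>\<^sup>+z\<in>Qbox I. ennreal (u' z) \<partial>lborel) \<le> ennreal Y \<and>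
    (\<integral>\<^sup>+z\<in>Qbox I. ennreal (inverse (u' z)) \<partial>lborel) \<le> ennreal Z \<and> Y * Z \<le> B * ((arc_len I)\<^sup>2)\<^sup>2"
    by (rule nn_integral_product_le[OF positive_versionD(2,3)[OF u] assms(4) F G FG FG_le dual])
  then obtain B where B: "0 \<le> B" "\<forall>I\<in>\<D>. \<exists>Y\<ge>0. \<exists>Z\<ge>0. (\<integral>\<^sup>+z\<in>Qbox I. ennreal (u' z) \<partial>lborel) \<le> ennreal Y \<and>
    (\<integral>\<^sup>+z\<in>Qbox I. ennreal (inverse (u' z)) \<partial>lborel) \<le> ennreal Z \<and> Y * Z \<le> B * ((arc_len I)\<^sup>2)\<^sup>2"
    by (elim exE conjE)
  show ?thesis
    by (rule Bclass_2I[OF u arc B(1) bspec[OF B(2)]])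
qed

end
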